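(* For any countably infinite group $\Gamma$, there exists a free minimal continuous action $\alpha:\Gamma\curvearrowright\mathcal{C}$ on the Cantor set $\mathcal{C}$ admitting an invariant Borel probability measure.
   Context: $\mathcal{C}=\{0,1\}^{\mathbb{N}}$ denotes the Cantor set. An action is free if $\alpha(\gamma)(x)\neq x$ for every point $x$ and every $\gamma\neq e_\Gamma$; it is minimal if every orbit is dense. *)

theory Defs
  imports "HOL-Algebra.Group_Action" "HOL-Probability.Probability"
begin

text \<open>
  The topology on \<^typ>\<open>bool\<close> is discrete, and functions carry the product topology, so this
  type with its type-class topology is the Cantor set.
\<close>
type_synonym cantor = "nat \<Rightarrow> bool"

text \<open>
  Since the acting group is discrete, joint continuity of the action amounts to continuity of
  each \<open>\<alpha> g\<close>.
\<close>
definition continuous_action ::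
    "('a, 'b) monoid_scheme \<Rightarrow> ('a \<Rightarrow> 'x \<Rightarrow> 'x::topological_space) \<Rightarrow> bool"
  where "continuous_action G \<alpha> \<longleftrightarrow>
    group_action G UNIV \<alpha> \<and> (\<forall>g\<in>carrier G. continuous_on UNIV (\<alpha> g))"

definition free_action :: "('a, 'b) monoid_scheme \<Rightarrow> ('a \<Rightarrow> 'x \<Rightarrow> 'x) \<Rightarrow> bool"
  where "free_action G \<alpha> \<longleftrightarrow> (\<forall>g\<in>carrier G. g \<noteq> \<one>\<^bsub>G\<^esub> \<longrightarrow> (\<forall>x. \<alpha> g x \<noteq> x))"

definition minimal_action ::
    "('a, 'b) monoid_scheme \<Rightarrow> ('a \<Rightarrow> 'x \<Rightarrow> 'x::topological_space) \<Rightarrow> bool"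
  where "minimal_action G \<alpha> \<longleftrightarrow> (\<forall>x. closure (Group_Action.orbit G \<alpha> x) = UNIV)"

definition invariant_borel_probability ::
    "('a, 'b) monoid_scheme \<Rightarrow> ('a \<Rightarrow> 'x \<Rightarrow> 'x::topological_space) \<Rightarrow> 'x measure \<Rightarrow> bool"
  where "invariant_borel_probability G \<alpha> \<mu> \<longleftrightarrow>
    prob_space \<mu> \<and> sets \<mu> = sets borel \<and> (\<forall>g\<in>carrier G. distr \<mu> borel (\<alpha> g) = \<mu>)"

end

theory Submission
  imports Defs
begin

text \<open>
  Fix a countably infinite group. A point of the model is a sequence of layers \<open>c\<^sub>0, c\<^sub>1, \<dots>\<close>, each a
  colouring of the group by natural numbers. It is encoded as the set of all triples
  \<open>(n, k, a)\<close> with \<open>c\<^sub>n k = a\<close>, that is, as a bit-valued function on a countable set, and the group acts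
  by left translation. The local rules are these.

  First, \<open>c\<^sub>n\<close> is a Grundy colouring of the graph joining \<open>k\<close> to \<open>k d\<close> for \<open>d\<close> in a finite symmetric
  set \<open>D\<^sub>n\<close>: it is proper, and a vertex of colour \<open>a\<close> has neighbours of all smaller colours. If \<open>g\<close>
  lies in \<open>D\<^sub>n\<close>, then the unit and \<open>g\<^sup>-\<^sup>1\<close> have different colours, so \<open>g\<close> cannot fix a point.
  As every nontrivial element lies in some \<open>D\<^sub>n\<close>, the action is free
  (\<open>limit_set_free\<close>). The Grundy condition makes the colours bounded and the points of colour
  \<open>0\<close> relatively dense.

  Second, around every point of colour \<open>0\<close> in layer \<open>n\<close> the lower layers carry a translate of a
  fixed finite pattern, the stamp \<open>P\<^sub>n\<close>. It is chosen universal: it contains a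
  copy of each pattern that configurations with \<open>n\<close> layers can show on a given finite window.
  So every pattern of every point recurs in every other point, and the action is minimal
  (\<open>limit_set_minimal\<close>).

  The set \<open>D\<^sub>n\<close> is chosen after \<open>P\<^sub>n\<close> and so large that stamps of layer \<open>n\<close> never touch one another.
  The stamp \<open>P\<^sub>n\<close> must be finite, yet compatible with all ways of filling in the rest. This is the
  notion of a self-contained patch. Every finite part of a legal configuration extends to such a patch
  inside that configuration (\<open>finite_self_contained_patch\<close>), far translates of such patches can be united
  because the group is infinite (\<open>exists_common_patch\<close>), and a consistent self-contained patch can always be
  completed from the top layer downwards: colour the rest of layer \<open>n\<close> greedily, stamp at the new zeros, and go on
  with layer \<open>n - 1\<close> (\<open>complete_layer_correct\<close>).

  Minimal subsystems of a system with an invariant measure need not carry one, so the measure has to be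
  built along with the rules. The greedy completion is equivariant and measurable once the vertices are
  scheduled by independent uniform labels. Hence the push-forward of the product measure is an
  invariant probability on the closed set of configurations whose first \<open>n\<close> layers are legal
  (\<open>exists_invariant_measure_on_legal\<close>). These sets decrease with \<open>n\<close>, and a compactness argument gives an
  invariant probability on their intersection (\<open>invariant_measure_on_Inter\<close>). Finally the
  intersection is a nonempty closed subset of a Cantor space; since the group is infinite and the action minimal
  and free, it has no isolated point, so it is itself a Cantor set (\<open>homeomorphic_Cantor\<close>).
\<close>

section \<open>The topology of spaces of bit-valued functions\<close>

instance bool :: second_countable_topology
proof
  show "\<exists>B::bool set set. countable B \<and> open = generate_topology B"
    by (intro exI[of _ "range lessThan \<union> range greaterThan"]) (auto simp: open_bool_def)
qed

text \<open>
  The three instances for \<open>fun\<close> are declared from the weakest separation axiom upwards, because an instance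
  for a class needs at least equally general instances for its superclasses.
\<close>

lemma separate_functions:
  fixes x y :: "'a \<Rightarrow> 'b::t2_space"
  assumes "x \<noteq> y"
  shows "\<exists>U V. open U \<and> open V \<and> x \<in> U \<and> y \<in> V \<and> U \<inter> V = {}"
proof -
  obtain i where i: "x i \<noteq> y i" using assms by auto
  from hausdorff[OF i] obtain U V where UV: "open U" "open V" "x i \<in> U" "y i \<in> V" "U \<inter> V = {}"
    by blast
  have "open ((\<lambda>f. f i) -` W :: ('a \<Rightarrow> 'b) set)" if "open W" for W
    using that by (rule open_vimage) simp
  then show ?thesis
    using UV by (intro exI[of _ "(\<lambda>f. f i) -` U"] exI[of _ "(\<lambda>f. f i) -` V"]) auto
qed

instance "fun" :: (type, t2_space) t0_space
proof
  fix x y :: "'a \<Rightarrow> 'b" assume "x \<noteq> y"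
  from separate_functions[OF this] show "\<exists>U. open U \<and> (x \<in> U) \<noteq> (y \<in> U)" by blast
qed

instance "fun" :: (type, t2_space) t1_space
proof
  fix x y :: "'a \<Rightarrow> 'b" assume "x \<noteq> y"
  from separate_functions[OF this] show "\<exists>U. open U \<and> x \<in> U \<and> y \<notin> U" by blast
qed

instance "fun" :: (type, t2_space) t2_space
proof
  fix x y :: "'a \<Rightarrow> 'b" assume "x \<noteq> y"
  then show "\<exists>U V. open U \<and> open V \<and> x \<in> U \<and> y \<in> V \<and> U \<inter> V = {}"
    by (rule separate_functions)
qed

lemma clopen_coordinate:
  fixes t :: 'i
  shows "closed {x :: 'i \<Rightarrow> bool. x t}" "open {x :: 'i \<Rightarrow> bool. x t}"
proof -
  have c: "continuous_on UNIV (\<lambda>x :: 'i \<Rightarrow> bool. x t)" by simp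
  have e: "{x :: 'i \<Rightarrow> bool. x t} = (\<lambda>x. x t) -` {True}" by auto
  show "open {x :: 'i \<Rightarrow> bool. x t}"
    unfolding e by (intro open_vimage discrete_topology_class.open_discrete c)
  show "closed {x :: 'i \<Rightarrow> bool. x t}"
    unfolding e by (rule closed_vimage[OF _ c]) simp
qed

definition clopen :: "'x::topological_space set \<Rightarrow> bool"
  where "clopen U \<longleftrightarrow> open U \<and> closed U"

lemma clopen_simps [simp]:
  "clopen {}" "clopen UNIV" "clopen U \<Longrightarrow> clopen (- U)"
  "clopen U \<Longrightarrow> clopen V \<Longrightarrow> clopen (U \<union> V)"
  "clopen U \<Longrightarrow> clopen V \<Longrightarrow> clopen (U \<inter> V)" "clopen U \<Longrightarrow> clopen V \<Longrightarrow> clopen (U - V)"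
  by (auto simp: clopen_def open_Diff closed_Diff)

definition cylinder :: "'i set \<Rightarrow> ('i \<Rightarrow> bool) \<Rightarrow> ('i \<Rightarrow> bool) set"
  where "cylinder F x = {y. \<forall>i\<in>F. y i = x i}"

lemma clopen_cylinder: "finite F \<Longrightarrow> clopen (cylinder F x)"
proof (induction F rule: finite_induct)
  case empty
  then show ?case by (simp add: cylinder_def)
next
  case (insert i F)
  have "cylinder (insert i F) x = cylinder F x \<inter> (if x i then {y. y i} else - {y. y i})"
    by (auto simp: cylinder_def)
  moreover have "clopen {y. y i}" by (simp add: clopen_def clopen_coordinate)
  ultimately show ?case using insert.IH by auto
qed

lemma open_contains_cylinder:
  fixes U :: "('i \<Rightarrow> bool) set"
  assumes "open U" "x \<in> U"
  shows "\<exists>F. finite F \<and> cylinder F x \<subseteq> U"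
proof -
  have "openin (product_topology (\<lambda>i. euclidean) UNIV) U"
    using assms by (simp add: open_fun_def)
  from product_topology_open_contains_basis[OF this \<open>x \<in> U\<close>] obtain X where
    X: "x \<in> (\<Pi>\<^sub>E i\<in>UNIV. X i)" "finite {i. X i \<noteq> (UNIV :: bool set)}" "(\<Pi>\<^sub>E i\<in>UNIV. X i) \<subseteq> U"
    by auto
  have "cylinder {i. X i \<noteq> UNIV} x \<subseteq> (\<Pi>\<^sub>E i\<in>UNIV. X i)"
  proof
    fix y assume y: "y \<in> cylinder {i. X i \<noteq> UNIV} x"
    have "y i \<in> X i" for i
    proof (cases "X i = UNIV")
      case False
      then have "y i = x i" using y by (simp add: cylinder_def)
      then show ?thesis using X(1) by auto
    qed auto
    then show "y \<in> (\<Pi>\<^sub>E i\<in>UNIV. X i)" by auto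
  qed
  with X show ?thesis by blast
qed

lemma self_in_cylinder [simp]: "x \<in> cylinder F x"
  by (simp add: cylinder_def)

lemma compact_Cantor: "compact (UNIV :: ('i \<Rightarrow> bool) set)"
proof -
  have "compactin (product_topology (\<lambda>i. euclidean) UNIV) (\<Pi>\<^sub>E i\<in>(UNIV :: 'i set). (UNIV :: bool set))"
    unfolding compactin_PiE by (simp add: finite_imp_compact)
  then have "compact (\<Pi>\<^sub>E i\<in>(UNIV :: 'i set). (UNIV :: bool set))"
    by (simp only: euclidean_product_topology compactin_euclidean_iff)
  then show ?thesis by (simp add: PiE_UNIV_domain)
qed

lemma compact_if_closed: "closed (S :: ('i \<Rightarrow> bool) set) \<Longrightarrow> compact S"
  using compact_Int_closed[OF compact_Cantor] by simp

section \<open>Invariant measures on decreasing intersections of closed sets\<close>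

lemma sigma_sets_clopen:
  "sigma_sets UNIV {U. clopen U} = sets (borel :: ('i::countable \<Rightarrow> bool) measure)"
proof
  show "sigma_sets UNIV {U. clopen U} \<subseteq> sets (borel :: ('i \<Rightarrow> bool) measure)"
    using sets.sigma_sets_subset[of "{U. clopen U}" "borel :: ('i \<Rightarrow> bool) measure"]
    by (simp add: clopen_def subset_eq)
  let ?S = "sigma UNIV {U :: ('i \<Rightarrow> bool) set. clopen U}"
  have "(\<lambda>x. x i) \<in> measurable ?S borel" for i
  proof (rule measurableI)
    fix A :: "bool set"
    have "clopen ((\<lambda>x. x i) -` A :: ('i \<Rightarrow> bool) set)"
      unfolding clopen_def
      unfolding closed_def vimage_Compl[symmetric]
      by (intro conjI open_vimage discrete_topology_class.open_discrete) simp_all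
    then show "(\<lambda>x. x i) -` A \<inter> space ?S \<in> sets ?S" by auto
  qed simp
  then have "(\<lambda>x. x) \<in> measurable ?S (Pi\<^sub>M UNIV (\<lambda>_ :: 'i. borel :: bool measure))"
    by (intro measurable_PiM_single') auto
  then have "sets (Pi\<^sub>M UNIV (\<lambda>_ :: 'i. borel :: bool measure)) \<subseteq> sets ?S"
    using measurable_sets[of "\<lambda>x. x" ?S] by (auto simp: space_PiM)
  then show "sets (borel :: ('i \<Rightarrow> bool) measure) \<subseteq> sigma_sets UNIV {U. clopen U}"
    by (simp add: sets_PiM_equal_borel)
qed

text \<open>
  Clopen sets form a base, and by the Lindelof property countably many of them cover an open set.
\<close>

lemma open_null_if_clopens_null:
  fixes \<mu> :: "('i::countable \<Rightarrow> bool) measure"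
  assumes "sets \<mu> = sets borel" "open W" "\<And>U. clopen U \<Longrightarrow> U \<subseteq> W \<Longrightarrow> emeasure \<mu> U = 0"
  shows "emeasure \<mu> W = 0"
proof -
  let ?F = "{U. clopen U \<and> U \<subseteq> W}"
  have W: "\<Union>?F = W"
  proof
    show "W \<subseteq> \<Union>?F"
    proof
      fix x assume "x \<in> W"
      then obtain F where "finite F" "cylinder F x \<subseteq> W"
        using open_contains_cylinder[OF \<open>open W\<close>] by blast
      then show "x \<in> \<Union>?F" using clopen_cylinder[of F x] self_in_cylinder[of x F] by blast
    qed
  qed auto
  obtain F' where F': "F' \<subseteq> ?F" "countable F'" "\<Union>F' = \<Union>?F"
    using Lindelof[of ?F] by (auto simp: clopen_def)
  have "U \<in> null_sets \<mu>" if "U \<in> F'" for U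
    using that F' assms by (auto simp: null_sets_def clopen_def)
  then have "(\<Union>U\<in>F'. U) \<in> null_sets \<mu>" by (rule null_sets_UN'[OF F'(2)])
  then show ?thesis using F' W by (simp add: null_sets_def)
qed

lemma Cantor_measure_eqI:
  fixes M N :: "('i::countable \<Rightarrow> bool) measure"
  assumes "sets M = sets borel" "sets N = sets borel" "finite_measure M"
    and "\<And>U. clopen U \<Longrightarrow> emeasure M U = emeasure N U"
  shows "M = N"
proof (rule measure_eqI_generator_eq[where E = "{U. clopen U}" and \<Omega> = UNIV and A = "\<lambda>_. UNIV"])
  show "emeasure M UNIV \<noteq> \<infinity>" using assms(1,3)
    by (metis finite_measure.emeasure_finite infinity_ennreal_def)
qed (use assms in \<open>auto simp: Int_stable_def sigma_sets_clopen\<close>)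

text \<open>
  A decreasing sequence of clopen sets with empty intersection is eventually empty, by compactness. So finite
  additivity on the algebra of clopen sets already gives the continuity that Caratheodory's theorem asks for.
\<close>

lemma finitely_additive_extends:
  fixes m :: "('i::countable \<Rightarrow> bool) set \<Rightarrow> real"
  assumes nonneg: "\<And>U. 0 \<le> m U"
    and add: "\<And>U V. clopen U \<Longrightarrow> clopen V \<Longrightarrow> U \<inter> V = {} \<Longrightarrow> m (U \<union> V) = m U + m V"
    and one: "m UNIV = 1"
  shows "\<exists>\<mu>. prob_space \<mu> \<and> sets \<mu> = sets borel \<and> (\<forall>U. clopen U \<longrightarrow> emeasure \<mu> U = ennreal (m U))"
proof -
  interpret A: algebra UNIV "{U :: ('i \<Rightarrow> bool) set. clopen U}"
    by (rule algebra_iff_Un[THEN iffD2]) (auto simp: Compl_eq_Diff_UNIV[symmetric])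
  have m0: "m {} = 0" using add[of "{}" "{}"] by simp
  let ?f = "\<lambda>U. ennreal (m U)"
  have "\<exists>\<mu>. (\<forall>s\<in>{U. clopen U}. \<mu> s = ?f s) \<and> measure_space UNIV (sigma_sets UNIV {U :: ('i \<Rightarrow> bool) set. clopen U}) \<mu>"
  proof (rule A.caratheodory_empty_continuous)
    show "positive {U. clopen U} ?f" by (simp add: positive_def m0)
    show "additive {U. clopen U} ?f"
      using add nonneg by (simp add: additive_def ennreal_plus[symmetric] del: ennreal_plus)
    show "\<And>A. ?f A \<noteq> \<infinity>" by simp
    fix A :: "nat \<Rightarrow> ('i \<Rightarrow> bool) set"
    assume A: "range A \<subseteq> {U. clopen U}" "decseq A" "(\<Inter>i. A i) = {}"
    have "\<exists>n. A n = {}"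
    proof (rule ccontr)
      assume ne: "\<nexists>n. A n = {}"
      have "UNIV \<inter> (\<Inter>i\<in>UNIV. A i) \<noteq> {}"
      proof (rule compact_imp_fip_image[OF compact_Cantor])
        show "closed (A i)" for i using A(1) by (auto simp: clopen_def)
        fix I :: "nat set" assume "finite I"
        then obtain N where "I \<subseteq> {..N}" using finite_nat_set_iff_bounded_le by auto
        then have "A N \<subseteq> (\<Inter>i\<in>I. A i)" using A(2) by (auto simp: decseq_def)
        then show "UNIV \<inter> (\<Inter>i\<in>I. A i) \<noteq> {}" using ne by blast
      qed
      then show False using A(3) by simp
    qed
    then obtain n where n: "A n = {}" by blast
    have "?f (A i) = 0" if "n \<le> i" for i
    proof -
      have "A i = {}" using A(2) n that by (auto simp: decseq_def)
      then show ?thesis by (simp add: m0)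
    qed
    then show "(\<lambda>i. ?f (A i)) \<longlonglongrightarrow> 0"
      by (intro tendsto_eventually eventually_sequentiallyI[of n])
  qed
  then obtain \<nu> where \<nu>: "\<And>U. clopen U \<Longrightarrow> \<nu> U = ?f U"
    "measure_space UNIV (sigma_sets UNIV {U :: ('i \<Rightarrow> bool) set. clopen U}) \<nu>"
    by auto
  define \<mu> where "\<mu> = measure_of UNIV {U :: ('i \<Rightarrow> bool) set. clopen U} \<nu>"
  have sets: "sets \<mu> = sets borel" by (simp add: \<mu>_def sigma_sets_clopen)
  have em: "emeasure \<mu> U = ?f U" if "clopen U" for U
  proof -
    have "emeasure \<mu> U = \<nu> U"
      by (rule emeasure_measure_of[OF \<mu>_def])
        (use \<nu>(2) that in \<open>auto simp: measure_space_def \<mu>_def\<close>)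
    then show ?thesis using \<nu>(1) that by simp
  qed
  have "space \<mu> = UNIV" by (simp add: \<mu>_def)
  then have "prob_space \<mu>" using em[of UNIV] one by (intro prob_spaceI) simp
  with sets em show ?thesis by blast
qed

lemma compact_unit_cube: "compact {m :: 's \<Rightarrow> real. \<forall>U. 0 \<le> m U \<and> m U \<le> 1}"
proof -
  have "compactin (product_topology (\<lambda>i. euclidean) UNIV) (\<Pi>\<^sub>E i\<in>(UNIV :: 's set). {0..1::real})"
    by (simp add: compactin_PiE)
  then have "compact (\<Pi>\<^sub>E i\<in>(UNIV :: 's set). {0..1::real})"
    by (simp add: euclidean_product_topology)
  also have "(\<Pi>\<^sub>E i\<in>(UNIV :: 's set). {0..1::real}) = {m. \<forall>U. 0 \<le> m U \<and> m U \<le> 1}"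
    by (auto simp: PiE_UNIV_domain Pi_iff)
  finally show ?thesis .
qed

text \<open>
  The real-valued set functions with values in the unit interval form a compact space under pointwise convergence. Being
  normalised, invariant, additive on clopen sets and null on the clopen sets that miss \<open>Z n\<close> are closed conditions,
  satisfied by the given measure on \<open>Z n\<close>. A set function that satisfies them for all \<open>n\<close> extends to
  the required measure.
\<close>

lemma invariant_measure_on_Inter:
  fixes T :: "'g \<Rightarrow> ('i::countable \<Rightarrow> bool) \<Rightarrow> ('i \<Rightarrow> bool)" and Z :: "nat \<Rightarrow> ('i \<Rightarrow> bool) set"
  assumes T: "\<And>g. continuous_on UNIV (T g)"
    and Z: "\<And>n. closed (Z n)" "decseq Z"
    and \<nu>: "\<And>n. \<exists>\<nu>. prob_space \<nu> \<and> sets \<nu> = sets borel \<and> (\<forall>g. distr \<nu> borel (T g) = \<nu>) \<and>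
      emeasure \<nu> (Z n) = 1"
  shows "\<exists>\<mu>. prob_space \<mu> \<and> sets \<mu> = sets borel \<and> (\<forall>g. distr \<mu> borel (T g) = \<mu>) \<and>
      emeasure \<mu> (\<Inter>n. Z n) = 1"
proof -
  define K where "K = {m :: ('i \<Rightarrow> bool) set \<Rightarrow> real. \<forall>U. 0 \<le> m U \<and> m U \<le> 1}"
  define C where "C n = {m :: ('i \<Rightarrow> bool) set \<Rightarrow> real.
    m UNIV = 1 \<and>
    (\<forall>U V. clopen U \<and> clopen V \<and> U \<inter> V = {} \<longrightarrow> m (U \<union> V) = m U + m V) \<and>
    (\<forall>g U. clopen U \<longrightarrow> m (T g -` U) = m U) \<and>
    (\<forall>U. clopen U \<and> U \<inter> Z n = {} \<longrightarrow> m U = 0)}" for n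
  have T': "T g \<in> borel_measurable borel" for g
    using T by (rule borel_measurable_continuous_onI)
  have clT: "clopen (T g -` U)" if "clopen U" for g U
    using that T by (auto simp: clopen_def intro: open_vimage closed_vimage)
  have clC: "closed (C n)" for n
    unfolding C_def
    by (intro closed_Collect_conj closed_Collect_all closed_Collect_imp open_Collect_const closed_Collect_eq
        continuous_on_add continuous_on_product_coordinates continuous_on_const)
  have ne: "K \<inter> C n \<noteq> {}" for n
  proof -
    obtain \<nu> where p: "prob_space \<nu>" and s: "sets \<nu> = sets borel"
      and i: "\<And>g. distr \<nu> borel (T g) = \<nu>" and z: "emeasure \<nu> (Z n) = 1"
      using \<nu> by blast
    interpret prob_space \<nu> by fact
    have sp: "space \<nu> = UNIV" using sets_eq_imp_space_eq[OF s] by simp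
    have cl: "U \<in> sets \<nu>" if "clopen U" for U using that by (simp add: s clopen_def)
    have zs: "Z n \<in> sets \<nu>" using Z by (simp add: s)
    have inv: "measure \<nu> (T g -` U) = measure \<nu> U" if "clopen U" for g U
    proof -
      have "measure \<nu> U = measure (distr \<nu> borel (T g)) U" by (simp add: i)
      also have "\<dots> = measure \<nu> (T g -` U \<inter> space \<nu>)"
        by (rule measure_distr) (use T' cl[OF that] s in \<open>auto cong: measurable_cong_sets\<close>)
      finally show ?thesis by (simp add: sp)
    qed
    have nul: "measure \<nu> U = 0" if "clopen U" "U \<inter> Z n = {}" for U
    proof -
      have "measure \<nu> (U \<union> Z n) = measure \<nu> U + measure \<nu> (Z n)"
        using that cl zs by (intro finite_measure_Union) auto
      moreover have "measure \<nu> (Z n) = 1" using z by (simp add: measure_def)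
      ultimately show ?thesis using prob_le_1[of "U \<union> Z n"] measure_nonneg[of \<nu> U] by linarith
    qed
    have "measure \<nu> \<in> K \<inter> C n"
      unfolding K_def C_def using inv nul cl prob_space sp
      by (auto intro: finite_measure_Union)
    then show ?thesis by blast
  qed
  have dec: "C N \<subseteq> C n" if "n \<le> N" for n N
  proof -
    have "Z N \<subseteq> Z n" using Z(2) that by (auto simp: decseq_def)
    then show ?thesis unfolding C_def by blast
  qed
  have "K \<inter> (\<Inter>n\<in>UNIV. C n) \<noteq> {}"
  proof (rule compact_imp_fip_image)
    show "compact K" unfolding K_def by (rule compact_unit_cube)
    show "closed (C n)" for n by (rule clC)
    fix I :: "nat set" assume "finite I"
    then obtain N where "I \<subseteq> {..N}" using finite_nat_set_iff_bounded_le by auto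
    then have "C N \<subseteq> (\<Inter>n\<in>I. C n)" using dec by blast
    then show "K \<inter> (\<Inter>n\<in>I. C n) \<noteq> {}" using ne[of N] by blast
  qed
  then obtain m where mK: "m \<in> K" and mC: "\<And>n. m \<in> C n" by blast
  have inv: "m (T g -` U) = m U" if "clopen U" for g U using mC[of 0] that by (simp add: C_def)
  have nul: "m U = 0" if "clopen U" "U \<inter> Z n = {}" for U n using mC[of n] that by (simp add: C_def)
  obtain \<mu> where p: "prob_space \<mu>" and s: "sets \<mu> = sets borel"
    and em: "\<And>U. clopen U \<Longrightarrow> emeasure \<mu> U = ennreal (m U)"
    using finitely_additive_extends[of m] mK mC[of 0] unfolding K_def C_def by auto
  interpret prob_space \<mu> by fact
  have sp: "space \<mu> = UNIV" using sets_eq_imp_space_eq[OF s] by simp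
  have Tm: "T g \<in> measurable \<mu> borel" for g using T'[of g] s by (simp cong: measurable_cong_sets)
  have "distr \<mu> borel (T g) = \<mu>" for g
  proof (rule Cantor_measure_eqI)
    show "finite_measure (distr \<mu> borel (T g))"
      using Tm by (intro finite_measure_distr)
    fix U :: "('i \<Rightarrow> bool) set" assume U: "clopen U"
    then have "emeasure (distr \<mu> borel (T g)) U = emeasure \<mu> (T g -` U \<inter> space \<mu>)"
      using Tm by (intro emeasure_distr) (auto simp: clopen_def)
    then show "emeasure (distr \<mu> borel (T g)) U = emeasure \<mu> U"
      using U by (simp add: sp em clT inv)
  qed (simp_all add: s)
  moreover have "emeasure \<mu> (\<Inter>n. Z n) = 1"
  proof -
    have "- Z n \<in> null_sets \<mu>" for n
    proof -
      have "emeasure \<mu> (- Z n) = 0"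
      proof (rule open_null_if_clopens_null[OF s])
        show "open (- Z n)" using Z(1) by (rule open_Compl)
        show "emeasure \<mu> U = 0" if "clopen U" "U \<subseteq> - Z n" for U
        proof -
          have "U \<inter> Z n = {}" using that by blast
          then show ?thesis using nul that by (simp add: em)
        qed
      qed
      then show ?thesis using Z by (simp add: null_sets_def s)
    qed
    then have "(\<Union>n. - Z n) \<in> null_sets \<mu>" by (rule null_sets_UN)
    moreover have "(\<Union>n. - Z n) = space \<mu> - (\<Inter>n. Z n)" by (auto simp: sp)
    moreover have "(\<Inter>n. Z n) \<in> sets \<mu>" using Z by (simp add: s borel_closed closed_INT)
    ultimately show ?thesis using emeasure_compl[of "\<Inter>n. Z n" \<mu>] emeasure_space_1
      by (metis null_setsD1 prob_compl emeasure_eq_measure ennreal_1 measure_eq_0_null_sets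
          diff_eq_diff_eq diff_zero eq_iff_diff_eq_0)
  qed
  ultimately show ?thesis using p s by blast
qed

section \<open>Perfect closed sets are Cantor sets\<close>

lemma card_below_enumerate:
  assumes "infinite (S :: nat set)"
  shows "card (S \<inter> {..<enumerate S r}) = r"
proof -
  have mono: "enumerate S m < enumerate S r \<longleftrightarrow> m < r" for m
    using assms by (metis enumerate_mono linorder_neqE_nat order_less_asym order_less_irrefl)
  have "S \<inter> {..<enumerate S r} = enumerate S ` {..<r}"
  proof
    show "S \<inter> {..<enumerate S r} \<subseteq> enumerate S ` {..<r}"
    proof
      fix n assume n: "n \<in> S \<inter> {..<enumerate S r}"
      then obtain m where "n = enumerate S m" using range_enumerate[OF assms] by blast
      then show "n \<in> enumerate S ` {..<r}" using n mono by auto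
    qed
    show "enumerate S ` {..<r} \<subseteq> S \<inter> {..<enumerate S r}"
      using mono enumerate_in_set[OF assms] by auto
  qed
  moreover have "inj_on (enumerate S) {..<r}"
    using assms by (metis enumerate_mono inj_onI linorder_neqE_nat order_less_irrefl)
  ultimately show ?thesis by (simp add: card_image)
qed

lemma enumerate_unique:
  assumes "infinite (S :: nat set)" "n \<in> S" "card (S \<inter> {..<n}) = r"
  shows "enumerate S r = n"
proof -
  obtain m where m: "n = enumerate S m" using range_enumerate[OF assms(1)] assms(2) by blast
  then have "m = r" using card_below_enumerate[OF assms(1), of m] assms(3) by simp
  then show ?thesis using m by simp
qed

lemma enumerate_cong_upto:
  assumes "infinite (S :: nat set)" "infinite T" "S \<inter> {..n} = T \<inter> {..n}" "enumerate S r \<le> n"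
  shows "enumerate T r = enumerate S r"
proof (rule enumerate_unique[OF assms(2)])
  let ?p = "enumerate S r"
  have "?p \<in> S \<inter> {..n}" using enumerate_in_set[OF assms(1)] assms(4) by simp
  then show "?p \<in> T" using assms(3) by blast
  have below: "R \<inter> {..<?p} = (R \<inter> {..n}) \<inter> {..<?p}" for R :: "nat set" using assms(4) by auto
  have "T \<inter> {..<?p} = S \<inter> {..<?p}" unfolding below[of S] below[of T] assms(3) ..
  then show "card (T \<inter> {..<?p}) = r" using card_below_enumerate[OF assms(1)] by simp
qed

lemma continuous_on_locally_constant:
  assumes "\<And>x. x \<in> S \<Longrightarrow> \<exists>U. open U \<and> x \<in> U \<and> (\<forall>y\<in>S \<inter> U. f y = f x)"
  shows "continuous_on S f"
  unfolding continuous_on_topological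
proof (intro ballI allI impI)
  fix x B assume "x \<in> S" and B: "f x \<in> B"
  then obtain U where "open U" "x \<in> U" "\<forall>y\<in>S \<inter> U. f y = f x" using assms by blast
  moreover from this B have "\<forall>y\<in>S. y \<in> U \<longrightarrow> f y \<in> B" by simp
  ultimately show "\<exists>A. open A \<and> x \<in> A \<and> (\<forall>y\<in>S. y \<in> A \<longrightarrow> f y \<in> B)" by blast
qed

text \<open>
  Enumerate the coordinates, and call \<open>n\<close> a branching position of \<open>x\<close> if some other point of \<open>Z\<close> leaves
  \<open>x\<close> exactly there. Without isolated points every \<open>x\<close> branches infinitely often. The homeomorphism reads off the
  bits of \<open>x\<close> at its branching positions and forgets the others, which are determined by the earlier bits.
\<close>

lemma homeomorphic_Cantor:
  fixes Z :: "('i::countable \<Rightarrow> bool) set"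
  assumes "closed Z" and "Z \<noteq> {}"
    and perfect: "\<And>x U. x \<in> Z \<Longrightarrow> open U \<Longrightarrow> x \<in> U \<Longrightarrow> \<exists>y\<in>Z. y \<in> U \<and> y \<noteq> x"
  shows "\<exists>(h :: ('i \<Rightarrow> bool) \<Rightarrow> nat \<Rightarrow> bool) h'. homeomorphism Z UNIV h h'"
proof -
  define e :: "nat \<Rightarrow> 'i" where "e = from_nat"
  define agree where "agree n x y \<longleftrightarrow> (\<forall>m<n. y (e m) = x (e m))" for n and x y :: "'i \<Rightarrow> bool"
  define branch where "branch x = {n. \<exists>y\<in>Z. agree n x y \<and> y (e n) \<noteq> x (e n)}" for x
  define pos where "pos x r = enumerate (branch x) r" for x r
  define h where "h x r = x (e (pos x r))" for x and r :: nat
  have agree_cyl: "{y. agree n x y} = cylinder (e ` {..<n}) x" for n x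
    by (auto simp: agree_def cylinder_def)
  have agree_open: "open {y. agree n x y}" for n x
    unfolding agree_cyl using clopen_cylinder[of "e ` {..<n}" x] by (simp add: clopen_def)
  have differ: "\<exists>n. agree n x y \<and> y (e n) \<noteq> x (e n)" if "x \<noteq> y" for x y
  proof -
    from that obtain i where "y i \<noteq> x i" by auto
    then have ex: "\<exists>n. y (e n) \<noteq> x (e n)" by (auto simp: e_def intro!: exI[of _ "to_nat i"])
    define n where "n = (LEAST n. y (e n) \<noteq> x (e n))"
    have "y (e n) \<noteq> x (e n)" unfolding n_def using ex by (rule LeastI_ex)
    moreover have "agree n x y" unfolding agree_def n_def using not_less_Least by blast
    ultimately show ?thesis by blast
  qed
  have inf: "infinite (branch x)" if "x \<in> Z" for x
    unfolding infinite_nat_iff_unbounded_le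
  proof
    fix N
    have "\<exists>y\<in>Z. y \<in> {y. agree N x y} \<and> y \<noteq> x"
      by (rule perfect[OF that agree_open]) (simp add: agree_def)
    then obtain y where y: "y \<in> Z" "agree N x y" "y \<noteq> x" by blast
    then obtain n where n: "agree n x y" "y (e n) \<noteq> x (e n)" using differ by metis
    have "N \<le> n" using y(2) n(2) by (meson agree_def not_le)
    then show "\<exists>n\<ge>N. n \<in> branch x" using y n by (auto simp: branch_def)
  qed
  have branch_eq: "branch x \<inter> {..n} = branch y \<inter> {..n}" if "x \<in> Z" "y \<in> Z" "agree n x y" for x y n
  proof -
    have "m \<in> branch x \<longleftrightarrow> m \<in> branch y" if "m \<le> n" for m
    proof (cases "x (e m) = y (e m)")
      case True
      have "agree m x w \<longleftrightarrow> agree m y w" for w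
        using \<open>agree n x y\<close> that by (simp add: agree_def)
      then show ?thesis using True by (simp add: branch_def)
    next
      case False
      have "agree m x y" "agree m y x" using \<open>agree n x y\<close> that by (simp_all add: agree_def)
      then show ?thesis using False \<open>x \<in> Z\<close> \<open>y \<in> Z\<close> by (auto simp: branch_def)
    qed
    then show ?thesis by auto
  qed
  have pos_eq: "pos y r = pos x r" if "x \<in> Z" "y \<in> Z" "agree n x y" "pos x r \<le> n" for x y n r
    using enumerate_cong_upto[OF inf inf branch_eq] that unfolding pos_def by blast
  have cont: "continuous_on Z h"
  proof (rule continuous_on_coordinatewise_then_product, rule continuous_on_locally_constant)
    fix r x assume x: "x \<in> Z"
    let ?n = "Suc (pos x r)"
    have "h y r = h x r" if "y \<in> Z \<inter> {y. agree ?n x y}" for y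
      using pos_eq[OF x, of y ?n r] that by (simp add: h_def agree_def)
    moreover have "x \<in> {y. agree ?n x y}" by (simp add: agree_def)
    ultimately show "\<exists>U. open U \<and> x \<in> U \<and> (\<forall>y\<in>Z \<inter> U. h y r = h x r)"
      using agree_open by blast
  qed
  have inj: "inj_on h Z"
  proof (rule inj_onI, rule ccontr)
    fix x y assume xy: "x \<in> Z" "y \<in> Z" "h x = h y" "x \<noteq> y"
    then obtain n where n: "agree n x y" "y (e n) \<noteq> x (e n)" using differ by blast
    then have "n \<in> branch x" using xy by (auto simp: branch_def)
    then obtain r where r: "pos x r = n"
      unfolding pos_def using range_enumerate[OF inf[OF xy(1)]] by (metis imageE)
    then have "pos y r = n" using pos_eq[OF xy(1,2) n(1), of r] by simp
    then have "h x r \<noteq> h y r" using r n by (simp add: h_def)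
    then show False using xy by simp
  qed
  \<comment> \<open>a wrong bit at a branching position is corrected by passing to a point that branches off there\<close>
  have approx: "\<exists>x\<in>Z. \<forall>r<R. h x r = z r" for z R
  proof (induction R)
    case 0
    then show ?case using \<open>Z \<noteq> {}\<close> by auto
  next
    case (Suc R)
    then obtain x where x: "x \<in> Z" "\<And>r. r < R \<Longrightarrow> h x r = z r" by blast
    show ?case
    proof (cases "h x R = z R")
      case True
      then show ?thesis using x less_Suc_eq by auto
    next
      case False
      let ?p = "pos x R"
      have "?p \<in> branch x" unfolding pos_def by (rule enumerate_in_set[OF inf[OF x(1)]])
      then obtain y where y: "y \<in> Z" "agree ?p x y" "y (e ?p) \<noteq> x (e ?p)"
        by (auto simp: branch_def)
      have "h y r = z r" if "r < Suc R" for r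
      proof (cases "r = R")
        case True
        then have "pos y r = ?p" using pos_eq[OF x(1) y(1,2), of R] by simp
        then show ?thesis using y False True by (auto simp: h_def)
      next
        case False
        then have "r < R" using that by simp
        then have "pos x r < ?p" unfolding pos_def by (rule enumerate_mono[OF _ inf[OF x(1)]])
        moreover from this have "pos y r = pos x r" using pos_eq[OF x(1) y(1,2), of r] by simp
        ultimately show ?thesis using x(2)[OF \<open>r < R\<close>] y(2) by (simp add: h_def agree_def)
      qed
      then show ?thesis using y(1) by blast
    qed
  qed
  have "compact (h ` Z)" using cont compact_if_closed[OF \<open>closed Z\<close>] by (rule compact_continuous_image)
  then have "open (- (h ` Z))" by (simp add: compact_imp_closed open_Compl)
  have surj: "h ` Z = UNIV"
  proof (rule ccontr)
    assume "h ` Z \<noteq> UNIV"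
    then obtain z where "z \<in> - (h ` Z)" by blast
    with \<open>open (- (h ` Z))\<close> obtain F where F: "finite F" "cylinder F z \<subseteq> - (h ` Z)"
      using open_contains_cylinder by blast
    obtain R where "F \<subseteq> {..<R}" using F(1) finite_nat_iff_bounded by blast
    moreover obtain x where "x \<in> Z" "\<forall>r<R. h x r = z r" using approx by blast
    ultimately have "h x \<in> cylinder F z" by (auto simp: cylinder_def)
    then show False using F(2) \<open>x \<in> Z\<close> by blast
  qed
  obtain h' where "homeomorphism Z UNIV h h'"
    using homeomorphism_compact[OF compact_if_closed[OF \<open>closed Z\<close>] cont surj inj] by blast
  then show ?thesis by blast
qed

section \<open>Independent uniform labels\<close>

definition iid_labels :: "('g::countable \<Rightarrow> real) measure"
  where "iid_labels = Pi\<^sub>M UNIV (\<lambda>_. uniform_measure lborel {0..<1})"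

lemma prob_space_unit: "prob_space (uniform_measure lborel {0..<1::real})"
  by (rule prob_space_uniform_measure) simp_all

lemma prob_space_iid_labels: "prob_space iid_labels"
  unfolding iid_labels_def by (rule prob_space_PiM) (rule prob_space_unit)

lemma space_iid_labels [simp]: "space iid_labels = UNIV"
  by (simp add: iid_labels_def space_PiM PiE_UNIV_domain)

lemma measurable_label [measurable]: "(\<lambda>u. u k) \<in> borel_measurable iid_labels"
proof -
  have "(\<lambda>u. u k) \<in> measurable iid_labels (uniform_measure lborel {0..<1})"
    unfolding iid_labels_def by (rule measurable_component_singleton) simp
  then show ?thesis by (simp cong: measurable_cong_sets)
qed

lemma iid_labels_permute:
  assumes "inj f"
  shows "distr iid_labels iid_labels (\<lambda>u k. u (f k)) = iid_labels"
  using distr_PiM_reindex[of UNIV "\<lambda>_. uniform_measure lborel {0..<1::real}" f UNIV] assms prob_space_unit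
  by (simp add: iid_labels_def restrict_UNIV)

lemma emeasure_labels_box:
  assumes "k \<noteq> l" "A \<in> sets borel"
  shows "emeasure iid_labels {u. u k \<in> A \<and> u l \<in> A} =
    emeasure (uniform_measure lborel {0..<1}) A * emeasure (uniform_measure lborel {0..<1}) A"
proof -
  interpret U: prob_space "uniform_measure lborel {0..<1::real}" by (rule prob_space_unit)
  interpret P: product_prob_space "\<lambda>_ :: 'a. uniform_measure lborel {0..<1::real}" UNIV
    by unfold_locales
  have "emeasure iid_labels {u \<in> space iid_labels. \<forall>i\<in>{k, l}. u i \<in> A} =
    (\<Prod>i\<in>{k, l}. emeasure (uniform_measure lborel {0..<1}) A)"
    unfolding iid_labels_def by (rule P.emeasure_PiM_Collect) (use assms in auto)
  then show ?thesis using \<open>k \<noteq> l\<close> by simp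
qed

text \<open>
  Cut the unit interval into \<open>N\<close> equal pieces. Equal labels lie in a common piece, and two independent labels do so
  with probability \<open>N * (1 / N)\<^sup>2 = 1 / N\<close>, for every \<open>N\<close>.
\<close>

lemma iid_labels_distinct:
  assumes "k \<noteq> l"
  shows "AE u in iid_labels. u k \<noteq> u l"
proof -
  interpret prob_space iid_labels by (rule prob_space_iid_labels)
  let ?U = "uniform_measure lborel {0..<1::real}"
  interpret U: prob_space ?U by (rule prob_space_unit)
  interpret P: product_prob_space "\<lambda>_ :: 'a. ?U" UNIV by unfold_locales
  have AE_unit: "AE u in iid_labels. u k \<in> {0..<1}" for k :: 'a
  proof -
    have "emeasure iid_labels {u \<in> space iid_labels. u k \<in> {0..<1}} = emeasure ?U {0..<1}"
      unfolding iid_labels_def by (rule P.emeasure_PiM_Collect_single) simp_all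
    also have "\<dots> = 1" by (simp add: emeasure_uniform_measure)
    finally have "prob {u \<in> space iid_labels. u k \<in> {0..<1}} = 1" by (simp add: measure_def)
    moreover have "{u \<in> space iid_labels. u k \<in> {0..<1}} \<in> events" by measurable
    ultimately show ?thesis using prob_Collect_eq_1[of "\<lambda>u. u k \<in> {0..<1}"] by blast
  qed
  have E: "{u. u k = u l} \<in> events"
  proof -
    have "{u \<in> space iid_labels. u k = u l} \<in> events" by measurable
    then show ?thesis by simp
  qed
  have "prob {u. u k = u l} \<le> 1 / real N" if "0 < N" for N :: nat
  proof -
    let ?I = "\<lambda>i. {real i / real N..<(real i + 1) / real N}"
    let ?B = "\<lambda>i. {u. u k \<in> ?I i \<and> u l \<in> ?I i}"
    have B: "?B i \<in> events" for i
    proof -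
      have "{u \<in> space iid_labels. u k \<in> ?I i \<and> u l \<in> ?I i} \<in> events" by measurable
      then show ?thesis by simp
    qed
    have pB: "prob (?B i) = (1 / real N) ^ 2" if "i < N" for i
    proof -
      have "{0..<1} \<inter> ?I i = ?I i"
        using that \<open>0 < N\<close> by (auto simp: field_simps)
      then have "emeasure ?U (?I i) = emeasure lborel (?I i) / emeasure lborel {0..<1::real}"
        by (subst emeasure_uniform_measure) simp_all
      also have "\<dots> = ennreal (1 / real N) / ennreal 1"
        using \<open>0 < N\<close> by (simp add: divide_right_mono diff_divide_distrib[symmetric])
      also have "\<dots> = ennreal (1 / real N)" by (subst divide_ennreal) simp_all
      finally have "emeasure ?U (?I i) = ennreal (1 / real N)" .
      then have "emeasure iid_labels (?B i) = ennreal ((1 / real N) ^ 2)"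
        using emeasure_labels_box[OF \<open>k \<noteq> l\<close>, of "?I i"]
        by (simp add: power2_eq_square ennreal_mult[symmetric])
      then show ?thesis by (simp add: measure_def)
    qed
    have "AE u in iid_labels. u \<in> {u. u k = u l} \<longrightarrow> u \<in> (\<Union>i<N. ?B i)"
      using AE_unit[of k]
    proof eventually_elim
      case (elim u)
      define i where "i = nat \<lfloor>real N * u k\<rfloor>"
      have i: "real i \<le> real N * u k" "real N * u k < real i + 1"
        using elim \<open>0 < N\<close> by (auto simp: i_def)
      moreover have "real N * u k < real N" using elim \<open>0 < N\<close> by simp
      ultimately have "i < N" by linarith
      moreover have "u k \<in> ?I i" using i \<open>0 < N\<close> by (auto simp: field_simps)
      ultimately show ?case by auto
    qed
    then have "prob {u. u k = u l} \<le> prob (\<Union>i<N. ?B i)"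
      by (rule finite_measure_mono_AE) (use B in auto)
    also have "\<dots> \<le> (\<Sum>i<N. prob (?B i))"
      by (rule finite_measure_subadditive_finite) (use B in auto)
    also have "\<dots> = 1 / real N"
      using pB \<open>0 < N\<close> by (simp add: power2_eq_square)
    finally show ?thesis .
  qed
  then have "prob {u. u k = u l} \<le> 0"
    by (intro LIMSEQ_le_const[OF lim_1_over_n[where 'a = real]] exI[of _ 1]) auto
  then have "prob {u. u k = u l} = 0" using measure_nonneg[of iid_labels] by (simp add: order_antisym)
  then have "{u. u k = u l} \<in> null_sets iid_labels"
    using E by (simp add: null_sets_def emeasure_eq_measure)
  then show ?thesis by (rule AE_I') auto
qed

lemma iid_labels_inj: "AE u in iid_labels. inj (u :: 'g::countable \<Rightarrow> real)"
proof -
  have "AE u in iid_labels. \<forall>p :: 'g \<times> 'g. fst p \<noteq> snd p \<longrightarrow> u (fst p) \<noteq> u (snd p)"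
    unfolding AE_all_countable
  proof
    fix p :: "'g \<times> 'g"
    show "AE u in iid_labels. fst p \<noteq> snd p \<longrightarrow> u (fst p) \<noteq> u (snd p)"
      using iid_labels_distinct[of "fst p" "snd p"] by (cases "fst p = snd p") auto
  qed
  then show ?thesis by (rule eventually_mono) (auto simp: inj_on_def)
qed

section \<open>Layered configurations on a group\<close>

text \<open>
  The acting group, written on a whole type: a countably infinite group can be carried over to the natural numbers.
\<close>

locale discrete_group = Groups.group mul one iv
  for mul :: "'g::countable \<Rightarrow> 'g \<Rightarrow> 'g" (infixl "\<odot>" 70) and one ("\<epsilon>") and iv :: "'g \<Rightarrow> 'g" +
  assumes infinite_group: "infinite (UNIV :: 'g set)"
begin

lemma iv_cancel [simp]: "iv g \<odot> (g \<odot> k) = k" "g \<odot> (iv g \<odot> k) = k"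
  by (simp_all add: assoc[symmetric])

lemma iv_move: "iv g \<odot> k = l \<longleftrightarrow> k = g \<odot> l"
  by (metis iv_cancel)

text \<open>
  Configurations and their finite parts, the patches, are sets of triples of a layer, a group element and its colour. So
  patches are overlaid by taking unions.
\<close>

definition translate :: "'g \<Rightarrow> (nat \<times> 'g \<times> nat) set \<Rightarrow> (nat \<times> 'g \<times> nat) set"
  where "translate g q = {(i, k, a). (i, iv g \<odot> k, a) \<in> q}"

lemma mem_translate [simp]: "(i, k, a) \<in> translate g q \<longleftrightarrow> (i, iv g \<odot> k, a) \<in> q"
  by (simp add: translate_def)

lemma translate_eq_image: "translate g q = (\<lambda>(i, k, a). (i, g \<odot> k, a)) ` q"
  by (force simp: translate_def image_iff iv_move)

lemma finite_translate: "finite q \<Longrightarrow> finite (translate g q)"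
  by (simp add: translate_eq_image)

definition proper :: "(nat \<Rightarrow> 'g set) \<Rightarrow> nat \<Rightarrow> (nat \<times> 'g \<times> nat) set \<Rightarrow> bool"
  where "proper D n q \<longleftrightarrow>
    (\<forall>i<n. \<forall>k a. (i, k, a) \<in> q \<longrightarrow>
      (\<forall>b. (i, k, b) \<in> q \<longrightarrow> a = b) \<and> (\<forall>d\<in>D i. (i, k \<odot> d, a) \<notin> q))"

text \<open>
  Together with \<open>proper\<close> this makes layer \<open>i\<close> a partial Grundy colouring: a greedy algorithm
  never uses a colour while a smaller one is free. The witnesses belong to the patch itself, so
  the condition is not spoiled by adding further points.
\<close>

definition witnessed :: "(nat \<Rightarrow> 'g set) \<Rightarrow> nat \<Rightarrow> (nat \<times> 'g \<times> nat) set \<Rightarrow> bool"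
  where "witnessed D n q \<longleftrightarrow>
    (\<forall>i<n. \<forall>k a. (i, k, a) \<in> q \<longrightarrow> (\<forall>v<a. \<exists>d\<in>D i. (i, k \<odot> d, v) \<in> q))"

definition stamped :: "(nat \<Rightarrow> (nat \<times> 'g \<times> nat) set) \<Rightarrow> nat \<Rightarrow> (nat \<times> 'g \<times> nat) set \<Rightarrow> bool"
  where "stamped P n q \<longleftrightarrow> (\<forall>j<n. \<forall>m. (j, m, 0) \<in> q \<longrightarrow> translate m (P j) \<subseteq> q)"

text \<open>
  The condition that makes a patch safe against later stamping. Suppose that layer \<open>j\<close> of \<open>q\<close> is completed
  to the whole group, and a stamp \<open>P j\<close> is placed at a new zero \<open>m\<close>. It may neither
  overlap nor be adjacent to a point \<open>k\<close> that \<open>q\<close> already colours in a lower layer \<open>i\<close>. Either \<open>k\<close> belongs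
  to a stamp of \<open>q\<close> from layer \<open>j\<close>, and then distinct zeros keep their distance, or every \<open>m\<close> whose stamp would come
  too close is already coloured by \<open>q\<close> in layer \<open>j\<close>.
\<close>

definition shielded ::
    "(nat \<Rightarrow> 'g set) \<Rightarrow> (nat \<Rightarrow> (nat \<times> 'g \<times> nat) set) \<Rightarrow> nat \<Rightarrow> (nat \<times> 'g \<times> nat) set \<Rightarrow> bool"
  where "shielded D P n q \<longleftrightarrow>
    (\<forall>j<n. \<forall>i<j. \<forall>k a. (i, k, a) \<in> q \<longrightarrow>
      (\<exists>m b. (j, m, 0) \<in> q \<and> (i, k, b) \<in> translate m (P j)) \<or>
      (\<forall>m b. \<forall>d\<in>insert \<epsilon> (D i). (i, k \<odot> d, b) \<in> translate m (P j) \<longrightarrow> (\<exists>c. (j, m, c) \<in> q)))"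

text \<open>
  The closure conditions on a patch. All three survive arbitrary unions and translations; only
  \<open>proper\<close> can fail for a union.
\<close>

definition self_contained ::
    "(nat \<Rightarrow> 'g set) \<Rightarrow> (nat \<Rightarrow> (nat \<times> 'g \<times> nat) set) \<Rightarrow> nat \<Rightarrow> (nat \<times> 'g \<times> nat) set \<Rightarrow> bool"
  where "self_contained D P n q \<longleftrightarrow> witnessed D n q \<and> stamped P n q \<and> shielded D P n q"

definition total :: "nat \<Rightarrow> (nat \<times> 'g \<times> nat) set \<Rightarrow> bool"
  where "total i q \<longleftrightarrow> (\<forall>k. \<exists>a. (i, k, a) \<in> q)"

definition legal ::
    "(nat \<Rightarrow> 'g set) \<Rightarrow> (nat \<Rightarrow> (nat \<times> 'g \<times> nat) set) \<Rightarrow> nat \<Rightarrow> (nat \<times> 'g \<times> nat) set \<Rightarrow> bool"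
  where "legal D P n q \<longleftrightarrow>
    proper D n q \<and> witnessed D n q \<and> stamped P n q \<and> (\<forall>i<n. total i q)"

lemma legal_mono: "legal D P n q \<Longrightarrow> m \<le> n \<Longrightarrow> legal D P m q"
  unfolding legal_def proper_def witnessed_def stamped_def by (meson order_less_le_trans)

lemma translate_translate: "translate g (translate h q) = translate (g \<odot> h) q"
  by (auto simp: translate_def inverse_distrib_swap assoc)

lemma proper_translate: "proper D n q \<Longrightarrow> proper D n (translate g q)"
  unfolding proper_def by (simp add: assoc[symmetric])

lemma witnessed_translate: "witnessed D n q \<Longrightarrow> witnessed D n (translate g q)"
  unfolding witnessed_def by (simp add: assoc[symmetric])

lemma translate_mono: "p \<subseteq> q \<Longrightarrow> translate g p \<subseteq> translate g q"
  by (auto simp: translate_def)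

lemma stamped_translate:
  assumes "stamped P n q" shows "stamped P n (translate g q)"
  unfolding stamped_def
proof (intro allI impI)
  fix j m assume "j < n" "(j, m, 0) \<in> translate g q"
  then have "translate (iv g \<odot> m) (P j) \<subseteq> q"
    using assms by (simp add: stamped_def)
  then have "translate g (translate (iv g \<odot> m) (P j)) \<subseteq> translate g q"
    by (rule translate_mono)
  then show "translate m (P j) \<subseteq> translate g q"
    by (simp add: translate_translate)
qed

lemma total_translate: "total i q \<Longrightarrow> total i (translate g q)"
  by (simp add: total_def)

lemma legal_translate: "legal D P n q \<Longrightarrow> legal D P n (translate g q)"
  unfolding legal_def
  by (simp add: proper_translate witnessed_translate stamped_translate total_translate)

lemma shielded_translate:
  assumes "shielded D P n q" shows "shielded D P n (translate g q)"
  unfolding shielded_def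
proof (intro allI impI)
  fix j i k a assume h: "j < n" "i < j" "(i, k, a) \<in> translate g q"
  then have "(i, iv g \<odot> k, a) \<in> q" by simp
  with assms h consider m b where "(j, m, 0) \<in> q" "(i, iv g \<odot> k, b) \<in> translate m (P j)"
    | "\<forall>m b. \<forall>d\<in>insert \<epsilon> (D i). (i, iv g \<odot> k \<odot> d, b) \<in> translate m (P j) \<longrightarrow> (\<exists>c. (j, m, c) \<in> q)"
    unfolding shielded_def by blast
  then show "(\<exists>m b. (j, m, 0) \<in> translate g q \<and> (i, k, b) \<in> translate m (P j)) \<or>
      (\<forall>m b. \<forall>d\<in>insert \<epsilon> (D i). (i, k \<odot> d, b) \<in> translate m (P j) \<longrightarrow>
        (\<exists>c. (j, m, c) \<in> translate g q))"
  proof cases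
    case 1
    then have "(j, g \<odot> m, 0) \<in> translate g q" "(i, k, b) \<in> translate (g \<odot> m) (P j)"
      by (simp_all add: inverse_distrib_swap assoc)
    then show ?thesis by blast
  next
    case 2
    have "\<exists>c. (j, m, c) \<in> translate g q"
      if "d \<in> insert \<epsilon> (D i)" "(i, k \<odot> d, b) \<in> translate m (P j)" for m b d
    proof -
      have "(i, iv g \<odot> k \<odot> d, b) \<in> translate (iv g \<odot> m) (P j)"
        using that by (simp add: inverse_distrib_swap assoc)
      with 2 that show ?thesis by auto
    qed
    then show ?thesis by blast
  qed
qed

lemma self_contained_translate: "self_contained D P n q \<Longrightarrow> self_contained D P n (translate g q)"
  unfolding self_contained_def
  by (simp add: witnessed_translate stamped_translate shielded_translate)

lemma self_contained_Union:
  assumes "\<And>q. q \<in> Q \<Longrightarrow> self_contained D P n q"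
  shows "self_contained D P n (\<Union>Q)"
proof -
  have "witnessed D n (\<Union>Q)" using assms
    unfolding self_contained_def witnessed_def by (meson Union_iff)
  moreover have "stamped P n (\<Union>Q)" using assms
    unfolding self_contained_def stamped_def by (meson Union_iff Union_upper order_trans)
  moreover have "shielded D P n (\<Union>Q)"
    unfolding shielded_def
  proof (intro allI impI)
    fix j i k a assume h: "j < n" "i < j" "(i, k, a) \<in> \<Union>Q"
    then obtain q where "q \<in> Q" "(i, k, a) \<in> q" by blast
    then have "(\<exists>m b. (j, m, 0) \<in> q \<and> (i, k, b) \<in> translate m (P j)) \<or>
      (\<forall>m b. \<forall>d\<in>insert \<epsilon> (D i). (i, k \<odot> d, b) \<in> translate m (P j) \<longrightarrow> (\<exists>c. (j, m, c) \<in> q))"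
      using assms h unfolding self_contained_def shielded_def by blast
    with \<open>q \<in> Q\<close> show "(\<exists>m b. (j, m, 0) \<in> \<Union>Q \<and> (i, k, b) \<in> translate m (P j)) \<or>
      (\<forall>m b. \<forall>d\<in>insert \<epsilon> (D i). (i, k \<odot> d, b) \<in> translate m (P j) \<longrightarrow> (\<exists>c. (j, m, c) \<in> \<Union>Q))"
      by blast
  qed
  ultimately show ?thesis by (simp add: self_contained_def)
qed

lemma self_contained_Un:
  "self_contained D P n p \<Longrightarrow> self_contained D P n q \<Longrightarrow> self_contained D P n (p \<union> q)"
  using self_contained_Union[of "{p, q}" D P n] by auto

text \<open>
  The \<open>a\<close> smaller colours are attained by \<open>a\<close> different neighbours.
\<close>

lemma colour_le_card:
  assumes "proper D n q" "witnessed D n q" "i < n" "finite (D i)" "(i, k, a) \<in> q"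
  shows "a \<le> card (D i)"
proof -
  have "\<forall>v\<in>{..<a}. \<exists>d. d \<in> D i \<and> (i, k \<odot> d, v) \<in> q"
    using assms unfolding witnessed_def by blast
  then obtain w where w: "\<And>v. v < a \<Longrightarrow> w v \<in> D i \<and> (i, k \<odot> w v, v) \<in> q"
    by (metis lessThan_iff)
  have "inj_on w {..<a}"
  proof (rule inj_onI)
    fix v v' assume h: "v \<in> {..<a}" "v' \<in> {..<a}" "w v = w v'"
    then have "(i, k \<odot> w v, v) \<in> q" "(i, k \<odot> w v, v') \<in> q" using w by force+
    then show "v = v'" using assms(1,3) unfolding proper_def by blast
  qed
  then have "card {..<a} \<le> card (D i)"
    by (rule card_inj_on_le) (use w assms in auto)
  then show ?thesis by simp
qed

text \<open>
  If stamps \<open>p\<close> at \<open>m\<close> and \<open>m'\<close> overlap or are adjacent in some layer, say \<open>m w d = m' w'\<close>, then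
  \<open>m\<close> and \<open>m'\<close> differ by the factor \<open>w d w'\<^sup>-\<^sup>1\<close>. So this says that stamps at distinct, non-\<open>E\<close>-adjacent points stay apart.
\<close>

definition stamps_separated :: "(nat \<Rightarrow> 'g set) \<Rightarrow> nat \<Rightarrow> (nat \<times> 'g \<times> nat) set \<Rightarrow> 'g set \<Rightarrow> bool"
  where "stamps_separated D n p E \<longleftrightarrow>
    (\<forall>i<n. \<forall>w a w' a'. (i, w, a) \<in> p \<longrightarrow> (i, w', a') \<in> p \<longrightarrow>
      (\<forall>d\<in>insert \<epsilon> (D i). w \<odot> d \<odot> iv w' \<in> insert \<epsilon> E))"

text \<open>
  The windows \<open>{k. to_nat k < n}\<close> exhaust the group as \<open>n\<close> grows, so each finite pattern is eventually contained in one.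
\<close>

definition universal ::
    "(nat \<Rightarrow> 'g set) \<Rightarrow> (nat \<Rightarrow> (nat \<times> 'g \<times> nat) set) \<Rightarrow> nat \<Rightarrow> (nat \<times> 'g \<times> nat) set \<Rightarrow> bool"
  where "universal D P n p \<longleftrightarrow>
    (\<forall>x. legal D P n x \<longrightarrow> (\<exists>u. \<forall>i<n. \<forall>k a. to_nat k < n \<longrightarrow> (i, k, a) \<in> x \<longrightarrow> (i, u \<odot> k, a) \<in> p))"

text \<open>
  Everything required of the graph and the stamp of layer \<open>n\<close>, given those of the layers below. The condition on
  \<open>from_nat n\<close> lets every nontrivial group element occur in some \<open>D n\<close>, which yields freeness.
\<close>

definition level_data ::
    "(nat \<Rightarrow> 'g set) \<Rightarrow> (nat \<Rightarrow> (nat \<times> 'g \<times> nat) set) \<Rightarrow> nat \<Rightarrow> bool"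
  where "level_data D P n \<longleftrightarrow>
    finite (D n) \<and> \<epsilon> \<notin> D n \<and> (\<forall>d\<in>D n. iv d \<in> D n) \<and> from_nat n \<in> insert \<epsilon> (D n) \<and>
    finite (P n) \<and> P n \<subseteq> {..<n} \<times> UNIV \<and> proper D n (P n) \<and> self_contained D P n (P n) \<and>
    stamps_separated D n (P n) (D n) \<and> universal D P n (P n)"

lemma level_dataD:
  assumes "level_data D P n"
  shows "finite (D n)" "\<epsilon> \<notin> D n" "\<And>d. d \<in> D n \<Longrightarrow> iv d \<in> D n"
    "from_nat n \<in> insert \<epsilon> (D n)" "finite (P n)" "P n \<subseteq> {..<n} \<times> UNIV" "proper D n (P n)"
    "self_contained D P n (P n)" "stamps_separated D n (P n) (D n)" "universal D P n (P n)"
  using assms unfolding level_data_def by simp_all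

lemma level_dependence:
  assumes D: "\<And>i. i < n \<Longrightarrow> D i = D' i" and P: "\<And>i. i < n \<Longrightarrow> P i = P' i"
  shows "proper D n q = proper D' n q"
    and "self_contained D P n q = self_contained D' P' n q"
    and "stamps_separated D n q E = stamps_separated D' n q E"
    and "universal D P n q = universal D' P' n q"
proof -
  have [simp]: "proper D n q = proper D' n q" "witnessed D n q = witnessed D' n q"
    "stamped P n q = stamped P' n q" for q
    unfolding proper_def witnessed_def stamped_def by (simp_all add: D P cong: imp_cong)
  have [simp]: "shielded D P n q = shielded D' P' n q" for q
    unfolding shielded_def by (simp add: D P cong: imp_cong conj_cong)
  have [simp]: "legal D P n q = legal D' P' n q" for q
    unfolding legal_def by simp
  show "proper D n q = proper D' n q"
    and "self_contained D P n q = self_contained D' P' n q"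
    and "universal D P n q = universal D' P' n q"
    by (simp_all add: self_contained_def universal_def)
  show "stamps_separated D n q E = stamps_separated D' n q E"
    unfolding stamps_separated_def by (simp add: D cong: imp_cong)
qed

text \<open>
  The data of level \<open>n\<close> involve the layers up to \<open>n\<close> only, which permits the recursive choice of all
  graphs and stamps.
\<close>

lemma level_data_cong:
  assumes "\<And>i. i \<le> n \<Longrightarrow> D i = D' i" and "\<And>i. i \<le> n \<Longrightarrow> P i = P' i"
  shows "level_data D P n \<longleftrightarrow> level_data D' P' n"
  using level_dependence[of n D D' P P'] assms[of n] assms
  unfolding level_data_def by simp

section \<open>Existence of universal stamps\<close>

text \<open>
  Witnesses have smaller colours than the vertices they serve, so the closure stops after as many rounds
  as there are colours.
\<close>

lemma finite_witness_closure:
  fixes c :: "('g \<times> nat) set"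
  assumes "finite E" and fin: "finite S"
    and wit: "\<And>k a v. (k, a) \<in> c \<Longrightarrow> v < a \<Longrightarrow> \<exists>d\<in>E. (k \<odot> d, v) \<in> c"
    and bd: "\<And>k a. (k, a) \<in> c \<Longrightarrow> a \<le> N"
    and "S \<subseteq> c"
  shows "\<exists>T. finite T \<and> S \<subseteq> T \<and> T \<subseteq> c \<and>
    (\<forall>k a. (k, a) \<in> T \<longrightarrow> (\<forall>v<a. \<exists>d\<in>E. (k \<odot> d, v) \<in> T))"
proof -
  have "\<exists>T. finite T \<and> S \<subseteq> T \<and> T \<subseteq> c \<and> (\<forall>k a. (k, a) \<in> T \<longrightarrow> (\<forall>v<a. \<exists>d\<in>E. (k \<odot> d, v) \<in> T))"
    if "finite S" "S \<subseteq> c" "\<And>k a. (k, a) \<in> S \<Longrightarrow> a \<le> r" for S r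
    using that
  proof (induction r arbitrary: S)
    case 0
    then show ?case by (intro exI[of _ S]) auto
  next
    case (Suc r)
    define S' where "S' = {(l, v) \<in> c. v \<le> r \<and> (\<exists>(k, a)\<in>S. \<exists>d\<in>E. l = k \<odot> d)}"
    have "S' \<subseteq> (\<lambda>((k, a), d). k \<odot> d) ` (S \<times> E) \<times> {..r}"
      by (force simp: S'_def)
    then have "finite S'" using Suc.prems \<open>finite E\<close> by (auto intro: finite_subset)
    moreover have "S' \<subseteq> c" "\<And>k a. (k, a) \<in> S' \<Longrightarrow> a \<le> r" by (auto simp: S'_def)
    ultimately have "\<exists>T. finite T \<and> S' \<subseteq> T \<and> T \<subseteq> c \<and>
      (\<forall>k a. (k, a) \<in> T \<longrightarrow> (\<forall>v<a. \<exists>d\<in>E. (k \<odot> d, v) \<in> T))"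
      by (rule Suc.IH)
    then obtain T where T: "finite T" "S' \<subseteq> T" "T \<subseteq> c"
      and T4: "\<forall>k a. (k, a) \<in> T \<longrightarrow> (\<forall>v<a. \<exists>d\<in>E. (k \<odot> d, v) \<in> T)"
      by (elim exE conjE) (rule that)
    have "\<exists>d\<in>E. (k \<odot> d, v) \<in> S \<union> T" if "(k, a) \<in> S \<union> T" "v < a" for k a v
    proof (cases "(k, a) \<in> T")
      case True
      then show ?thesis using T4[rule_format, OF True \<open>v < a\<close>] by blast
    next
      case False
      then have S: "(k, a) \<in> S" using that by blast
      then have "(k, a) \<in> c" using Suc.prems(2) by blast
      then obtain d where d: "d \<in> E" "(k \<odot> d, v) \<in> c" using wit \<open>v < a\<close> by blast
      have "a \<le> Suc r" using S Suc.prems(3) by blast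
      then have "(k \<odot> d, v) \<in> S'" using d S that by (auto simp: S'_def)
      then show ?thesis using d T by blast
    qed
    then have "\<forall>k a. (k, a) \<in> S \<union> T \<longrightarrow> (\<forall>v<a. \<exists>d\<in>E. (k \<odot> d, v) \<in> S \<union> T)" by blast
    moreover have "finite (S \<union> T)" "S \<union> T \<subseteq> c" using Suc.prems(1,2) T(1,3) by simp_all
    ultimately show ?case by blast
  qed
  from this[of S N] show ?thesis using fin \<open>S \<subseteq> c\<close> bd by blast
qed

text \<open>
  By induction on the number of layers. Inside a legal configuration unions are harmless, as they remain proper.
  So it is enough to enlarge a patch \<open>q0\<close> of the lower layers in three steps: take in the
  finitely many vertices of layer \<open>n\<close> whose stamps could come close to \<open>q0\<close>, close up under witnesses, and add the
  stamps of all zeros among them.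
\<close>

lemma finite_self_contained_patch:
  assumes "legal D P n x" and "\<And>j. j < n \<Longrightarrow> level_data D P j" and "finite F"
  shows "\<exists>q. finite q \<and> q \<subseteq> x \<and> q \<subseteq> {..<n} \<times> UNIV \<and> self_contained D P n q \<and>
    (\<forall>i<n. \<forall>k\<in>F. \<forall>a. (i, k, a) \<in> x \<longrightarrow> (i, k, a) \<in> q)"
  using assms
proof (induction n)
  case 0
  show ?case
    by (intro exI[of _ "{}"])
      (simp add: self_contained_def witnessed_def stamped_def shielded_def)
next
  case (Suc n)
  have leg: "legal D P n x" using Suc.prems(1) by (rule legal_mono) simp
  have data: "level_data D P n" using Suc.prems by simp
  obtain q0 where q0: "finite q0" "q0 \<subseteq> x" "q0 \<subseteq> {..<n} \<times> UNIV" "self_contained D P n q0"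
    "\<And>i k a. i < n \<Longrightarrow> k \<in> F \<Longrightarrow> (i, k, a) \<in> x \<Longrightarrow> (i, k, a) \<in> q0"
    using Suc.IH[OF leg Suc.prems(2) Suc.prems(3)] by (metis less_SucI)
  have pro: "proper D (Suc n) x" and wit: "witnessed D (Suc n) x" and st: "stamped P (Suc n) x"
    and tot: "total n x"
    using Suc.prems(1) by (auto simp: legal_def)
  have finD: "finite (D i)" if "i \<le> n" for i
    using Suc.prems(2)[of i] that by (auto simp: level_data_def)
  \<comment> \<open>a stamp of layer \<open>n\<close> at \<open>m\<close> meets or touches \<open>k\<close> iff \<open>m = k d w\<^sup>-\<^sup>1\<close> for a position \<open>w\<close> of the stamp\<close>
  define M where "M = F \<union> (\<Union>(i, k, a)\<in>q0. \<Union>d\<in>insert \<epsilon> (D i). \<Union>(i', w, b)\<in>P n. {k \<odot> d \<odot> iv w})"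
  have "finite M"
    unfolding M_def using \<open>finite F\<close> q0 finD data by (auto simp: level_data_def)
  define S where "S = {(k, a). k \<in> M \<and> (n, k, a) \<in> x}"
  have bd: "a \<le> card (D n)" if "(n, k, a) \<in> x" for k a
    using colour_le_card[OF pro wit _ _ that] finD by simp
  have "S \<subseteq> M \<times> {..card (D n)}" using bd by (auto simp: S_def)
  then have "finite S" using \<open>finite M\<close> by (auto intro: finite_subset)
  define c where "c = {(k, a). (n, k, a) \<in> x}"
  have c: "(k, a) \<in> c \<longleftrightarrow> (n, k, a) \<in> x" for k a by (simp add: c_def)
  have "\<exists>T. finite T \<and> S \<subseteq> T \<and> T \<subseteq> c \<and> (\<forall>k a. (k, a) \<in> T \<longrightarrow> (\<forall>v<a. \<exists>d\<in>D n. (k \<odot> d, v) \<in> T))"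
  proof (rule finite_witness_closure)
    show "finite (D n)" using finD by simp
    show "finite S" by fact
    show "S \<subseteq> c" by (auto simp: S_def c_def)
    show "a \<le> card (D n)" if "(k, a) \<in> c" for k a using that bd by (simp add: c)
    show "\<exists>d\<in>D n. (k \<odot> d, v) \<in> c" if "(k, a) \<in> c" "v < a" for k a v
      using that wit by (simp add: witnessed_def c)
  qed
  then have "\<exists>T. finite T \<and> S \<subseteq> T \<and> T \<subseteq> {(k, a). (n, k, a) \<in> x} \<and>
    (\<forall>k a. (k, a) \<in> T \<longrightarrow> (\<forall>v<a. \<exists>d\<in>D n. (k \<odot> d, v) \<in> T))" unfolding c_def .
  then obtain T where T: "finite T" "S \<subseteq> T" "T \<subseteq> {(k, a). (n, k, a) \<in> x}"
    and T4: "\<forall>k a. (k, a) \<in> T \<longrightarrow> (\<forall>v<a. \<exists>d\<in>D n. (k \<odot> d, v) \<in> T)"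
    by (elim exE conjE) (rule that)
  define L where "L = (\<lambda>(k, a). (n, k, a)) ` T"
  define R where "R = \<Union>((\<lambda>m. translate m (P n)) ` {m. (m, 0) \<in> T})"
  define q where "q = (q0 \<union> R) \<union> L"
  have memL [simp]: "(i, k, a) \<in> L \<longleftrightarrow> i = n \<and> (k, a) \<in> T" for i k a
    by (auto simp: L_def)
  have Plow: "i < n" if "(i, w, b) \<in> P n" for i w b
    using data that by (auto simp: level_data_def)
  have Rlow: "i < n" if "(i, w, b) \<in> R" for i w b
    using that by (auto simp: R_def dest: Plow)
  have finZ: "finite {m. (m, 0) \<in> T}"
    by (rule finite_subset[of _ "fst ` T"]) (use T in force)+
  have "finite R"
    unfolding R_def using finZ data by (auto simp: level_data_def intro: finite_translate)
  have Rx: "R \<subseteq> x"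
    unfolding R_def
  proof (rule UN_least)
    fix m assume "m \<in> {m. (m, 0) \<in> T}"
    then have "(n, m, 0) \<in> x" using T(3) by blast
    then show "translate m (P n) \<subseteq> x" using st by (simp add: stamped_def)
  qed
  have sub: "q \<subseteq> x" using q0 Rx T(3) by (auto simp: q_def L_def)
  have low: "q \<subseteq> {..<Suc n} \<times> UNIV"
    using q0 by (auto simp: q_def L_def dest!: Rlow)
  have "self_contained D P n R"
    unfolding R_def using level_dataD(8)[OF data]
    by (intro self_contained_Union) (auto intro: self_contained_translate)
  then have sc: "self_contained D P n (q0 \<union> R)" using q0 by (simp add: self_contained_Un)
  have eq: "(i, k, a) \<in> q \<longleftrightarrow> (i, k, a) \<in> q0 \<union> R" if "i < n" for i k a
    using that by (auto simp: q_def)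
  have qn: "(n, k, a) \<in> q \<longleftrightarrow> (k, a) \<in> T" for k a
    using q0(3) Rlow[of n k a] by (auto simp: q_def)
  have "witnessed D (Suc n) q"
    unfolding witnessed_def
  proof (intro allI impI)
    fix i k a v assume h: "i < Suc n" "(i, k, a) \<in> q" "v < a"
    show "\<exists>d\<in>D i. (i, k \<odot> d, v) \<in> q"
    proof (cases "i = n")
      case True
      then show ?thesis using h T4 by (simp add: qn)
    next
      case False
      then have "i < n" using h by simp
      then show ?thesis
        using h sc unfolding eq[OF \<open>i < n\<close>] self_contained_def witnessed_def by blast
    qed
  qed
  moreover have "stamped P (Suc n) q"
    unfolding stamped_def
  proof (intro allI impI)
    fix j m assume h: "j < Suc n" "(j, m, 0) \<in> q"
    show "translate m (P j) \<subseteq> q"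
    proof (cases "j = n")
      case True
      then have "(m, 0) \<in> T" using h(2) qn by simp
      then have "translate m (P n) \<subseteq> R" unfolding R_def by blast
      then show ?thesis using True by (auto simp: q_def)
    next
      case False
      then have "j < n" using h by simp
      then have "translate m (P j) \<subseteq> q0 \<union> R"
        using h sc unfolding eq[OF \<open>j < n\<close>] self_contained_def stamped_def by blast
      then show ?thesis by (auto simp: q_def)
    qed
  qed
  moreover have "shielded D P (Suc n) q"
    unfolding shielded_def
  proof (intro allI impI)
    fix j i k a assume h: "j < Suc n" "i < j" "(i, k, a) \<in> q"
    show "(\<exists>m b. (j, m, 0) \<in> q \<and> (i, k, b) \<in> translate m (P j)) \<or>
      (\<forall>m b. \<forall>d\<in>insert \<epsilon> (D i). (i, k \<odot> d, b) \<in> translate m (P j) \<longrightarrow> (\<exists>c. (j, m, c) \<in> q))"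
    proof (cases "j = n")
      case True
      then have "(i, k, a) \<in> q0 \<or> (i, k, a) \<in> R" using h eq by simp
      then show ?thesis
      proof
        assume k: "(i, k, a) \<in> q0"
        have "\<exists>c. (n, m, c) \<in> q" if "d \<in> insert \<epsilon> (D i)" "(i, k \<odot> d, b) \<in> translate m (P n)" for m b d
        proof -
          have "k \<odot> d \<odot> iv (iv m \<odot> (k \<odot> d)) \<in> M"
            using that k unfolding M_def by fastforce
          moreover have "k \<odot> d \<odot> iv (iv m \<odot> (k \<odot> d)) = m"
            by (simp add: inverse_distrib_swap assoc)
          ultimately have "m \<in> M" by (simp only:)
          moreover obtain c where "(n, m, c) \<in> x" using tot by (auto simp: total_def)
          ultimately have "(m, c) \<in> T" using T(2) by (auto simp: S_def)
          then show ?thesis using qn by blast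
        qed
        then show ?thesis using True by blast
      next
        assume "(i, k, a) \<in> R"
        then obtain m where "(m, 0) \<in> T" "(i, k, a) \<in> translate m (P n)"
          by (auto simp: R_def)
        then show ?thesis using True qn by blast
      qed
    next
      case False
      then have "j < n" using h by simp
      then have "(\<exists>m b. (j, m, 0) \<in> q0 \<union> R \<and> (i, k, b) \<in> translate m (P j)) \<or>
        (\<forall>m b. \<forall>d\<in>insert \<epsilon> (D i). (i, k \<odot> d, b) \<in> translate m (P j) \<longrightarrow> (\<exists>c. (j, m, c) \<in> q0 \<union> R))"
        using h sc eq[of i k a] unfolding self_contained_def shielded_def by (meson less_trans)
      then show ?thesis using eq[OF \<open>j < n\<close>] by blast
    qed
  qed
  ultimately have "self_contained D P (Suc n) q" by (simp add: self_contained_def)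
  moreover have "(i, k, a) \<in> q" if "i < Suc n" "k \<in> F" "(i, k, a) \<in> x" for i k a
  proof (cases "i = n")
    case True
    then have "(k, a) \<in> S" using that by (simp add: S_def M_def)
    then show ?thesis using T True by (auto simp: qn)
  next
    case False
    then show ?thesis using that q0(5) by (simp add: q_def)
  qed
  moreover have "finite q" using q0 \<open>finite R\<close> T by (simp add: q_def L_def)
  ultimately show ?case using sub low by blast
qed

lemma exists_far_translate:
  assumes "finite A" "finite B"
  shows "\<exists>u. \<forall>a\<in>A. \<forall>b\<in>B. u \<odot> b \<noteq> a"
proof -
  have "finite ((\<lambda>(a, b). a \<odot> iv b) ` (A \<times> B))" using assms by simp
  then obtain u where u: "u \<notin> (\<lambda>(a, b). a \<odot> iv b) ` (A \<times> B)"
    using infinite_group ex_new_if_finite by blast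
  have "u \<odot> b \<noteq> a" if "a \<in> A" "b \<in> B" for a b
  proof
    assume "u \<odot> b = a"
    then have "u = a \<odot> iv b" by (auto simp: assoc)
    with u that show False by force
  qed
  then show ?thesis by blast
qed

text \<open>
  Here the group must be infinite: there is always room for one more patch far from the previous ones.
\<close>

lemma exists_common_patch:
  assumes data: "\<And>j. j < n \<Longrightarrow> level_data D P j" and "finite X" and "\<And>x. x \<in> X \<Longrightarrow> legal D P n x"
    and "finite F"
  shows "\<exists>p. finite p \<and> p \<subseteq> {..<n} \<times> UNIV \<and> proper D n p \<and> self_contained D P n p \<and>
    (\<forall>x\<in>X. \<exists>u. \<forall>i<n. \<forall>k\<in>F. \<forall>a. (i, k, a) \<in> x \<longrightarrow> (i, u \<odot> k, a) \<in> p)"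
  using assms(2,3)
proof (induction X)
  case empty
  show ?case
    by (intro exI[of _ "{}"])
      (simp add: self_contained_def witnessed_def stamped_def shielded_def proper_def)
next
  case (insert x X)
  have "\<And>x. x \<in> X \<Longrightarrow> legal D P n x" using insert by simp
  from insert.IH[OF this] obtain p where p: "finite p" "p \<subseteq> {..<n} \<times> UNIV" "proper D n p" "self_contained D P n p"
    "\<And>x. x \<in> X \<Longrightarrow> \<exists>u. \<forall>i<n. \<forall>k\<in>F. \<forall>a. (i, k, a) \<in> x \<longrightarrow> (i, u \<odot> k, a) \<in> p"
    by blast
  have leg: "legal D P n x" using insert by simp
  obtain q where q: "finite q" "q \<subseteq> x" "q \<subseteq> {..<n} \<times> UNIV" "self_contained D P n q"
    "\<And>i k a. i < n \<Longrightarrow> k \<in> F \<Longrightarrow> (i, k, a) \<in> x \<Longrightarrow> (i, k, a) \<in> q"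
    using finite_self_contained_patch[OF leg data \<open>finite F\<close>] by blast
  define E where "E = insert \<epsilon> (\<Union>i<n. D i)"
  have "finite E" using data by (auto simp: E_def level_data_def)
  define K where "K = (\<lambda>(i, k, a). k) ` p"
  define K' where "K' = (\<lambda>(i, k, a). k) ` q"
  have "finite ((\<lambda>(k, d). k \<odot> d) ` (K \<times> E))" "finite K'"
    using p q \<open>finite E\<close> by (auto simp: K_def K'_def)
  then obtain u where "\<forall>a\<in>(\<lambda>(k, d). k \<odot> d) ` (K \<times> E). \<forall>b\<in>K'. u \<odot> b \<noteq> a"
    using exists_far_translate by meson
  then have far: "u \<odot> b \<noteq> k \<odot> d" if "k \<in> K" "d \<in> E" "b \<in> K'" for k d b
    using that by force
  have nopt: "False" if "(i, k, a) \<in> p" "(i, k \<odot> d, b) \<in> translate u q" "d \<in> E" for i k a b d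
    using far[of k d "iv u \<odot> (k \<odot> d)"] that by (force simp: K_def K'_def)
  have symD: "iv d \<in> D i" if "d \<in> D i" "i < n" for d i
    using data[of i] that by (auto simp: level_data_def)
  have "proper D n x" using leg by (simp add: legal_def)
  then have "proper D n q" using q(2) unfolding proper_def by blast
  then have q': "proper D n (translate u q)" by (rule proper_translate)
  define p' where "p' = p \<union> translate u q"
  have "proper D n p'"
    unfolding proper_def
  proof (intro allI impI conjI ballI)
    fix i k a b assume h: "i < n" "(i, k, a) \<in> p'" "(i, k, b) \<in> p'"
    show "a = b"
      using h p(3) q' nopt[of i k _ \<epsilon>] unfolding p'_def proper_def E_def
      by (metis Un_iff insertI1 right_neutral)
  next
    fix i k a d assume h: "i < n" "(i, k, a) \<in> p'" "d \<in> D i"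
    have dE: "d \<in> E" "iv d \<in> E" using h symD by (auto simp: E_def)
    show "(i, k \<odot> d, a) \<notin> p'"
    proof
      assume h': "(i, k \<odot> d, a) \<in> p'"
      have "\<not> ((i, k, a) \<in> p \<and> (i, k \<odot> d, a) \<in> p)" using p(3) h unfolding proper_def by blast
      moreover have "\<not> ((i, k, a) \<in> translate u q \<and> (i, k \<odot> d, a) \<in> translate u q)"
        using q' h unfolding proper_def by blast
      moreover have "\<not> ((i, k, a) \<in> p \<and> (i, k \<odot> d, a) \<in> translate u q)"
        using nopt dE by blast
      moreover have "\<not> ((i, k \<odot> d, a) \<in> p \<and> (i, k, a) \<in> translate u q)"
        using nopt[of i "k \<odot> d" a "iv d" a] dE by (auto simp: assoc)
      ultimately show False using h h' by (auto simp: p'_def)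
    qed
  qed
  moreover have "self_contained D P n p'"
    unfolding p'_def using p q by (intro self_contained_Un self_contained_translate)
  moreover have "finite p'" using p q by (simp add: p'_def finite_translate)
  moreover have "p' \<subseteq> {..<n} \<times> UNIV" using p q by (auto simp: p'_def translate_def)
  moreover have "\<exists>v. \<forall>i<n. \<forall>k\<in>F. \<forall>a. (i, k, a) \<in> y \<longrightarrow> (i, v \<odot> k, a) \<in> p'"
    if "y \<in> insert x X" for y
  proof (cases "y = x")
    case True
    have "\<forall>i<n. \<forall>k\<in>F. \<forall>a. (i, k, a) \<in> x \<longrightarrow> (i, u \<odot> k, a) \<in> p'"
      using q(5) by (simp add: p'_def)
    then show ?thesis using True by blast
  next
    case False
    then show ?thesis using p(5) that unfolding p'_def by blast
  qed
  ultimately show ?case by blast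
qed

text \<open>
  Colours are bounded, so legal configurations show only finitely many patterns on the window.
\<close>

lemma exists_universal_patch:
  assumes data: "\<And>j. j < n \<Longrightarrow> level_data D P j"
  shows "\<exists>p. finite p \<and> p \<subseteq> {..<n} \<times> UNIV \<and> proper D n p \<and> self_contained D P n p \<and>
    universal D P n p"
proof -
  define F where "F = {k::'g. to_nat k < n}"
  have "finite F" unfolding F_def
    by (rule finite_imageD[of to_nat]) (auto intro: finite_subset[of _ "{..<n}"] inj_on_subset[OF inj_to_nat])
  define B where "B = (\<Union>i<n. {i} \<times> F \<times> {..card (D i)})"
  have "finite B" using \<open>finite F\<close> by (auto simp: B_def)
  define r where "r x = x \<inter> {..<n} \<times> F \<times> UNIV" for x :: "(nat \<times> 'g \<times> nat) set"
  have "r x \<subseteq> B" if "legal D P n x" for x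
  proof -
    have "a \<le> card (D i)" if "(i, k, a) \<in> x" "i < n" for i k a
      using colour_le_card[of D n x i k a] \<open>legal D P n x\<close> data[of i] that
      by (auto simp: legal_def level_data_def)
    then show ?thesis by (auto simp: r_def B_def)
  qed
  then have "r ` {x. legal D P n x} \<subseteq> Pow B" by auto
  then have "finite (r ` {x. legal D P n x})" using \<open>finite B\<close> finite_subset by blast
  then obtain X where X: "X \<subseteq> {x. legal D P n x}" "finite X" "r ` {x. legal D P n x} = r ` X"
    by (metis (no_types, lifting) finite_subset_image subset_refl)
  have legX: "\<And>x. x \<in> X \<Longrightarrow> legal D P n x" using X(1) by blast
  obtain p where p: "finite p" "p \<subseteq> {..<n} \<times> UNIV" "proper D n p" "self_contained D P n p"
    and px: "\<And>x. x \<in> X \<Longrightarrow> \<exists>u. \<forall>i<n. \<forall>k\<in>F. \<forall>a. (i, k, a) \<in> x \<longrightarrow> (i, u \<odot> k, a) \<in> p"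
    using exists_common_patch[OF data X(2) legX \<open>finite F\<close>] by meson
  have "universal D P n p"
    unfolding universal_def
  proof (intro allI impI)
    fix x assume "legal D P n x"
    then have "r x \<in> r ` X" using X(3) by blast
    then obtain y where y: "y \<in> X" "r x = r y" by blast
    from px[OF y(1)] obtain u where u: "\<And>i k a. i < n \<Longrightarrow> k \<in> F \<Longrightarrow> (i, k, a) \<in> y \<Longrightarrow> (i, u \<odot> k, a) \<in> p"
      by blast
    have "(i, u \<odot> k, a) \<in> p" if "i < n" "to_nat k < n" "(i, k, a) \<in> x" for i k a
    proof -
      have "(i, k, a) \<in> r x" using that by (simp add: r_def F_def)
      then have "(i, k, a) \<in> r y" by (simp only: y(2))
      then have "(i, k, a) \<in> y" by (simp add: r_def)
      then show ?thesis using u that by (simp add: F_def)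
    qed
    then show "\<exists>u. \<forall>i<n. \<forall>k a. to_nat k < n \<longrightarrow> (i, k, a) \<in> x \<longrightarrow> (i, u \<odot> k, a) \<in> p"
      by blast
  qed
  with p show ?thesis by blast
qed

text \<open>
  The stamp comes first. Afterwards the graph can be chosen large enough to keep its copies apart.
\<close>

lemma exists_level_data:
  assumes data: "\<And>j. j < n \<Longrightarrow> level_data D P j"
  shows "\<exists>E p. level_data (D(n := E)) (P(n := p)) n"
proof -
  obtain p where p: "finite p" "p \<subseteq> {..<n} \<times> UNIV" "proper D n p" "self_contained D P n p"
    "universal D P n p"
    using exists_universal_patch[OF data] by blast
  define E0 where "E0 = insert (from_nat n)
    (\<Union>(i, w, a)\<in>p. \<Union>(i', w', a')\<in>p. \<Union>d\<in>insert \<epsilon> (D i). {w \<odot> d \<odot> iv w'})"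
  define E where "E = (E0 \<union> iv ` E0) - {\<epsilon>}"
  have "finite (D i)" if "(i, w, a) \<in> p" for i w a
    using p(2) that data[of i] by (auto simp: level_data_def)
  then have "finite E0" using p(1) unfolding E0_def by fastforce
  then have "finite E" by (simp add: E_def)
  have inv_e: "iv d = \<epsilon> \<longleftrightarrow> d = \<epsilon>" for d by (metis inverse_inverse inverse_neutral)
  have "iv d \<in> E" if "d \<in> E" for d
    using that by (auto simp: E_def inv_e)
  moreover have "stamps_separated D n p E"
    unfolding stamps_separated_def
  proof (intro allI impI ballI)
    fix i w a w' a' d assume "(i, w, a) \<in> p" "(i, w', a') \<in> p" "d \<in> insert \<epsilon> (D i)"
    then have "w \<odot> d \<odot> iv w' \<in> E0" unfolding E0_def by blast
    then show "w \<odot> d \<odot> iv w' \<in> insert \<epsilon> E" by (auto simp: E_def)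
  qed
  moreover have "from_nat n \<in> insert \<epsilon> E" by (auto simp: E_def E0_def)
  moreover have "\<epsilon> \<notin> E" by (simp add: E_def)
  ultimately have E: "finite E \<and> \<epsilon> \<notin> E \<and> (\<forall>d\<in>E. iv d \<in> E) \<and> from_nat n \<in> insert \<epsilon> E \<and>
    stamps_separated D n p E" using \<open>finite E\<close> by blast
  have agree: "D i = (D(n := E)) i" "P i = (P(n := p)) i" if "i < n" for i
    using that by simp_all
  note cong = level_dependence[of n D "D(n := E)" P "P(n := p)", OF agree]
  have "level_data (D(n := E)) (P(n := p)) n"
    unfolding level_data_def using E p by (simp add: cong)
  then show ?thesis by blast
qed

lemma exists_all_level_data: "\<exists>D P. \<forall>n. level_data D P n"
proof -
  define R where "R f n r \<longleftrightarrow> level_data (\<lambda>i. if i < n then fst (f i) else fst r)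
    (\<lambda>i. if i < n then snd (f i) else snd r) n"
    for f :: "nat \<Rightarrow> 'g set \<times> (nat \<times> 'g \<times> nat) set" and n r
  have "\<exists>f. \<forall>n. R f n (f n)"
  proof (rule dependent_wellorder_choice)
    fix r n and f g :: "nat \<Rightarrow> 'g set \<times> (nat \<times> 'g \<times> nat) set" assume "\<And>i. i < n \<Longrightarrow> f i = g i"
    then show "R f n r = R g n r" unfolding R_def by (simp cong: if_cong)
  next
    fix n and f :: "nat \<Rightarrow> 'g set \<times> (nat \<times> 'g \<times> nat) set" assume IH: "\<And>i. i < n \<Longrightarrow> R f i (f i)"
    let ?D = "\<lambda>i. fst (f i)" and ?P = "\<lambda>i. snd (f i)"
    have "level_data ?D ?P j" if "j < n" for j
    proof -
      have "level_data ?D ?P j = level_data (\<lambda>i. if i < j then fst (f i) else fst (f j))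
        (\<lambda>i. if i < j then snd (f i) else snd (f j)) j"
        by (rule level_data_cong) auto
      then show ?thesis using IH[OF that] by (simp add: R_def)
    qed
    from exists_level_data[OF this] obtain E p where
      E: "level_data (?D(n := E)) (?P(n := p)) n" by blast
    have "level_data (?D(n := E)) (?P(n := p)) n = level_data (\<lambda>i. if i < n then fst (f i) else E)
        (\<lambda>i. if i < n then snd (f i) else p) n"
      by (rule level_data_cong) auto
    then have "R f n (E, p)" using E unfolding R_def fst_conv snd_conv by simp
    then show "\<exists>r. R f n r" by blast
  qed
  then obtain f where f: "\<And>n. R f n (f n)" by blast
  have "level_data (\<lambda>i. fst (f i)) (\<lambda>i. snd (f i)) n" for n
  proof -
    have "level_data (\<lambda>i. fst (f i)) (\<lambda>i. snd (f i)) n =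
      level_data (\<lambda>i. if i < n then fst (f i) else fst (f n))
        (\<lambda>i. if i < n then snd (f i) else snd (f n)) n"
      by (rule level_data_cong) auto
    then show ?thesis using f[of n] by (simp add: R_def)
  qed
  then show ?thesis by blast
qed

section \<open>Greedy colourings\<close>

text \<open>
  At time \<open>t\<close> every uncoloured vertex of \<open>A t\<close> receives the least colour that none of its neighbours has. The sets
  \<open>A t\<close> will be independent, so simultaneous choices do not interfere.
\<close>

primrec greedy :: "'g set \<Rightarrow> (nat \<Rightarrow> 'g set) \<Rightarrow> ('g \<times> nat) set \<Rightarrow> nat \<Rightarrow> ('g \<times> nat) set"
  where
    "greedy E A R 0 = R"
  | "greedy E A R (Suc t) = greedy E A R t \<union>
      {(k, a). k \<in> A t \<and> (\<forall>b. (k, b) \<notin> greedy E A R t) \<and>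
        (\<forall>d\<in>E. (k \<odot> d, a) \<notin> greedy E A R t) \<and>
        (\<forall>v<a. \<exists>d\<in>E. (k \<odot> d, v) \<in> greedy E A R t)}"

definition greedy_colouring :: "'g set \<Rightarrow> (nat \<Rightarrow> 'g set) \<Rightarrow> ('g \<times> nat) set \<Rightarrow> ('g \<times> nat) set"
  where "greedy_colouring E A R = (\<Union>t. greedy E A R t)"

definition grundy :: "'g set \<Rightarrow> ('g \<times> nat) set \<Rightarrow> bool"
  where "grundy E R \<longleftrightarrow>
    (\<forall>k a. (k, a) \<in> R \<longrightarrow> (\<forall>b. (k, b) \<in> R \<longrightarrow> a = b) \<and> (\<forall>d\<in>E. (k \<odot> d, a) \<notin> R) \<and>
      (\<forall>v<a. \<exists>d\<in>E. (k \<odot> d, v) \<in> R))"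

lemma greedy_mono: "s \<le> t \<Longrightarrow> greedy E A R s \<subseteq> greedy E A R t"
  by (rule lift_Suc_mono_le[of "greedy E A R"]) auto

lemma grundy_greedy:
  assumes R: "grundy E R" and sym: "\<And>d. d \<in> E \<Longrightarrow> iv d \<in> E"
    and indep: "\<And>t k d. k \<in> A t \<Longrightarrow> d \<in> E \<Longrightarrow> k \<odot> d \<notin> A t"
  shows "grundy E (greedy E A R t)"
proof (induction t)
  case 0
  show ?case using R by simp
next
  case (Suc t)
  let ?G = "greedy E A R t"
  define N where "N = {(k, a). k \<in> A t \<and> (\<forall>b. (k, b) \<notin> ?G) \<and>
        (\<forall>d\<in>E. (k \<odot> d, a) \<notin> ?G) \<and> (\<forall>v<a. \<exists>d\<in>E. (k \<odot> d, v) \<in> ?G)}"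
  have N: "(k, a) \<in> N \<longleftrightarrow> k \<in> A t \<and> (\<forall>b. (k, b) \<notin> ?G) \<and>
        (\<forall>d\<in>E. (k \<odot> d, a) \<notin> ?G) \<and> (\<forall>v<a. \<exists>d\<in>E. (k \<odot> d, v) \<in> ?G)" for k a
    by (simp add: N_def)
  have G: "greedy E A R (Suc t) = ?G \<union> N" by (simp add: N_def)
  have IH: "(\<forall>b. (k, b) \<in> ?G \<longrightarrow> a = b) \<and> (\<forall>d\<in>E. (k \<odot> d, a) \<notin> ?G) \<and>
      (\<forall>v<a. \<exists>d\<in>E. (k \<odot> d, v) \<in> ?G)" if "(k, a) \<in> ?G" for k a
    using Suc.IH that unfolding grundy_def by blast
  have NN: "a = b" if "(k, a) \<in> N" "(k, b) \<in> N" for k a b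
    using that unfolding N by (meson linorder_neqE_nat)
  show ?case
    unfolding grundy_def G
  proof (intro allI impI conjI ballI)
    fix k a b assume "(k, a) \<in> ?G \<union> N" "(k, b) \<in> ?G \<union> N"
    then show "a = b" using IH NN N by blast
  next
    fix k a d assume h: "(k, a) \<in> ?G \<union> N" "d \<in> E"
    show "(k \<odot> d, a) \<notin> ?G \<union> N"
    proof
      assume h': "(k \<odot> d, a) \<in> ?G \<union> N"
      have "\<not> ((k, a) \<in> ?G \<and> (k \<odot> d, a) \<in> ?G)" using IH h by blast
      moreover have "\<not> ((k, a) \<in> N \<and> (k \<odot> d, a) \<in> ?G)" using N h by blast
      moreover have "\<not> ((k, a) \<in> N \<and> (k \<odot> d, a) \<in> N)" using N indep h by blast
      moreover have "\<not> ((k, a) \<in> ?G \<and> (k \<odot> d, a) \<in> N)"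
        using N[of "k \<odot> d" a] sym[OF h(2)] by (auto simp: assoc)
      ultimately show False using h h' by blast
    qed
  next
    fix k a v assume "(k, a) \<in> ?G \<union> N" "v < a"
    then show "\<exists>d\<in>E. (k \<odot> d, v) \<in> ?G \<union> N" using IH N by blast
  qed
qed

text \<open>
  A vertex has finitely many neighbours, each with at most one colour, so some least colour is free.
\<close>

lemma greedy_defined:
  assumes "finite E" and G: "grundy E (greedy E A R t)" and "k \<in> A t"
  shows "\<exists>a. (k, a) \<in> greedy E A R (Suc t)"
proof (cases "\<exists>b. (k, b) \<in> greedy E A R t")
  case True
  then show ?thesis by auto
next
  case False
  define U where "U = {a. \<exists>d\<in>E. (k \<odot> d, a) \<in> greedy E A R t}"
  have "U \<subseteq> (\<Union>d\<in>E. {a. (k \<odot> d, a) \<in> greedy E A R t})" by (auto simp: U_def)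
  moreover have "finite {a. (l, a) \<in> greedy E A R t}" for l
  proof (cases "\<exists>a. (l, a) \<in> greedy E A R t")
    case True
    then obtain a where "(l, a) \<in> greedy E A R t" by blast
    then have "{a. (l, a) \<in> greedy E A R t} \<subseteq> {a}" using G unfolding grundy_def by blast
    then show ?thesis by (rule finite_subset) simp
  qed simp
  ultimately have "finite U" using \<open>finite E\<close> by (meson finite_UN finite_subset)
  then have ex: "\<exists>a. a \<notin> U" using ex_new_if_finite infinite_UNIV_nat by blast
  define a where "a = (LEAST a. a \<notin> U)"
  have "a \<notin> U" unfolding a_def using ex by (rule LeastI_ex)
  moreover have "v \<in> U" if "v < a" for v
    using not_less_Least[of v "\<lambda>a. a \<notin> U"] that by (simp add: a_def)
  ultimately have "(k, a) \<in> greedy E A R (Suc t)"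
    using False \<open>k \<in> A t\<close> by (simp add: U_def)
  then show ?thesis by blast
qed

lemma grundy_greedy_colouring:
  assumes R: "grundy E R" and sym: "\<And>d. d \<in> E \<Longrightarrow> iv d \<in> E"
    and indep: "\<And>t k d. k \<in> A t \<Longrightarrow> d \<in> E \<Longrightarrow> k \<odot> d \<notin> A t"
  shows "grundy E (greedy_colouring E A R)"
proof -
  have G: "grundy E (greedy E A R t)" for t
    by (rule grundy_greedy[OF R]) (use sym indep in blast)+
  have mem: "(k, a) \<in> greedy_colouring E A R \<longleftrightarrow> (\<exists>t. (k, a) \<in> greedy E A R t)" for k a
    by (simp add: greedy_colouring_def)
  have lift: "(k, a) \<in> greedy E A R s \<Longrightarrow> (k, a) \<in> greedy E A R (max s t)"
    "(k, a) \<in> greedy E A R t \<Longrightarrow> (k, a) \<in> greedy E A R (max s t)" for k a s t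
    using greedy_mono[of s "max s t" E A R] greedy_mono[of t "max s t" E A R] by auto
  show ?thesis
    unfolding grundy_def
  proof (intro allI impI conjI ballI)
    fix k a b assume "(k, a) \<in> greedy_colouring E A R" "(k, b) \<in> greedy_colouring E A R"
    then obtain s t where "(k, a) \<in> greedy E A R s" "(k, b) \<in> greedy E A R t" by (auto simp: mem)
    then have "(k, a) \<in> greedy E A R (max s t)" "(k, b) \<in> greedy E A R (max s t)"
      by (simp_all add: lift)
    then show "a = b" using G[of "max s t"] unfolding grundy_def by blast
  next
    fix k a d assume d: "d \<in> E" and "(k, a) \<in> greedy_colouring E A R"
    then obtain s where s: "(k, a) \<in> greedy E A R s" by (auto simp: mem)
    show "(k \<odot> d, a) \<notin> greedy_colouring E A R"
    proof
      assume "(k \<odot> d, a) \<in> greedy_colouring E A R"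
      then obtain t where "(k \<odot> d, a) \<in> greedy E A R t" by (auto simp: mem)
      with s have "(k, a) \<in> greedy E A R (max s t)" "(k \<odot> d, a) \<in> greedy E A R (max s t)"
        by (simp_all add: lift)
      then show False using G[of "max s t"] d unfolding grundy_def by blast
    qed
  next
    fix k a v assume "(k, a) \<in> greedy_colouring E A R" "v < a"
    then show "\<exists>d\<in>E. (k \<odot> d, v) \<in> greedy_colouring E A R"
      using G unfolding grundy_def mem by blast
  qed
qed

lemma greedy_colouring_total:
  assumes R: "grundy E R" and sym: "\<And>d. d \<in> E \<Longrightarrow> iv d \<in> E" and "finite E"
    and indep: "\<And>t k d. k \<in> A t \<Longrightarrow> d \<in> E \<Longrightarrow> k \<odot> d \<notin> A t"
    and cover: "\<And>k. \<exists>t. k \<in> A t"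
  shows "\<exists>a. (k, a) \<in> greedy_colouring E A R"
proof -
  obtain t where "k \<in> A t" using cover by blast
  moreover have "grundy E (greedy E A R t)"
    by (rule grundy_greedy[OF R]) (use sym indep in blast)+
  ultimately have "\<exists>a. (k, a) \<in> greedy E A R (Suc t)"
    using greedy_defined[OF \<open>finite E\<close>] by blast
  then show ?thesis by (auto simp: greedy_colouring_def simp del: greedy.simps)
qed

lemma greedy_translate:
  "(k, a) \<in> greedy E (\<lambda>t. {k. g \<odot> k \<in> A t}) {(k, a). (g \<odot> k, a) \<in> R} t \<longleftrightarrow>
    (g \<odot> k, a) \<in> greedy E A R t"
proof (induction t arbitrary: k a)
  case (Suc t)
  show ?case by (simp only: greedy.simps Un_iff mem_Collect_eq case_prod_conv Suc.IH assoc)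
qed simp

section \<open>Completing a configuration layer by layer\<close>

text \<open>
  \<open>A j\<close> is the schedule for layer \<open>j\<close>. Zeros already present in \<open>q\<close> are stamped again, which changes nothing if
  \<open>q\<close> is stamped.
\<close>

definition complete_layer ::
    "(nat \<Rightarrow> 'g set) \<Rightarrow> (nat \<Rightarrow> (nat \<times> 'g \<times> nat) set) \<Rightarrow> (nat \<Rightarrow> nat \<Rightarrow> 'g set) \<Rightarrow> nat \<Rightarrow>
      (nat \<times> 'g \<times> nat) set \<Rightarrow> (nat \<times> 'g \<times> nat) set"
  where "complete_layer D P A j q =
    (let L = greedy_colouring (D j) (A j) {(k, a). (j, k, a) \<in> q}
     in q \<union> {(i, k, a). i = j \<and> (k, a) \<in> L} \<union> (\<Union>m\<in>{m. (m, 0) \<in> L}. translate m (P j)))"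

primrec complete ::
    "(nat \<Rightarrow> 'g set) \<Rightarrow> (nat \<Rightarrow> (nat \<times> 'g \<times> nat) set) \<Rightarrow> (nat \<Rightarrow> nat \<Rightarrow> 'g set) \<Rightarrow> nat \<Rightarrow>
      (nat \<times> 'g \<times> nat) set \<Rightarrow> (nat \<times> 'g \<times> nat) set"
  where
    "complete D P A 0 q = q"
  | "complete D P A (Suc n) q = complete D P A n (complete_layer D P A n q)"

definition schedule :: "'g set \<Rightarrow> (nat \<Rightarrow> 'g set) \<Rightarrow> bool"
  where "schedule E A \<longleftrightarrow>
    (\<forall>t. \<forall>k\<in>A t. \<forall>d\<in>E. k \<odot> d \<notin> A t) \<and> (\<forall>k. \<exists>t. k \<in> A t)"

lemma grundy_layer:
  assumes "proper D n q" "witnessed D n q" "i < n"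
  shows "grundy (D i) {(k, a). (i, k, a) \<in> q}"
  using assms unfolding proper_def witnessed_def grundy_def by simp

text \<open>
  A lower-layer triple of the result comes either from \<open>q\<close> or from the stamp of a new zero. New stamps keep their
  distance from each other by separation, and from \<open>q\<close> because \<open>q\<close> is shielded. So no two triples
  from different sources are in conflict, while the closure conditions pass from \<open>q\<close> and from the stamp to the union.
\<close>

lemma complete_layer_correct:
  assumes data: "level_data D P j" and data': "\<And>i. i < n \<Longrightarrow> level_data D P i" and "j < n"
    and A: "schedule (D j) (A j)"
    and q: "proper D n q" "self_contained D P n q" "\<And>i. j < i \<Longrightarrow> i < n \<Longrightarrow> total i q"
  defines "q' \<equiv> complete_layer D P A j q"
  shows "proper D n q' \<and> self_contained D P n q' \<and> (\<forall>i<n. j \<le> i \<longrightarrow> total i q')"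
proof -
  define L where "L = greedy_colouring (D j) (A j) {(k, a). (j, k, a) \<in> q}"
  have wq: "witnessed D n q" and sq: "stamped P n q" and shq: "shielded D P n q"
    using q(2) by (auto simp: self_contained_def)
  note P = level_dataD[OF data]
  have wP: "witnessed D j (P j)" and sP: "stamped P j (P j)" and shP: "shielded D P j (P j)"
    using P(8) by (auto simp: self_contained_def)
  have gr: "grundy (D j) {(k, a). (j, k, a) \<in> q}"
    using q(1) wq \<open>j < n\<close> by (rule grundy_layer)
  have indep: "k \<in> A j t \<Longrightarrow> d \<in> D j \<Longrightarrow> k \<odot> d \<notin> A j t" for t k d
    using A unfolding schedule_def by blast
  have cov: "\<exists>t. k \<in> A j t" for k using A unfolding schedule_def by blast
  have L: "grundy (D j) L"
    unfolding L_def by (rule grundy_greedy_colouring[OF gr P(3) indep])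
  have Ltot: "\<exists>a. (k, a) \<in> L" for k
    unfolding L_def by (rule greedy_colouring_total[OF gr P(3,1) indep cov])
  have qL: "(k, a) \<in> L" if "(j, k, a) \<in> q" for k a
    unfolding L_def greedy_colouring_def using that by (auto intro!: exI[of _ 0])
  have Lfun: "a = b" if "(k, a) \<in> L" "(k, b) \<in> L" for k a b
    using L that unfolding grundy_def by blast
  have Lprop: "(k \<odot> d, a) \<notin> L" if "(k, a) \<in> L" "d \<in> D j" for k a d
    using L that unfolding grundy_def by blast
  \<comment> \<open>only the stamps of new zeros add anything to \<open>q\<close>\<close>
  define W where "W = (\<Union>m\<in>{m. (m, 0) \<in> L \<and> (\<forall>a. (j, m, a) \<notin> q)}. translate m (P j))"
  have old: "translate m (P j) \<subseteq> q" if "(m, 0) \<in> L" "(j, m, a) \<in> q" for m a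
  proof -
    have "a = 0" using Lfun qL that by blast
    then show ?thesis using sq that \<open>j < n\<close> unfolding stamped_def by blast
  qed
  have q'_eq: "q' = q \<union> {(i, k, a). i = j \<and> (k, a) \<in> L} \<union> W"
    unfolding q'_def complete_layer_def Let_def L_def[symmetric] W_def using old by blast
  have Pj: "i < j" if "(i, w, a) \<in> P j" for i w a using P(6) that by blast
  have Wlow: "i < j" if "(i, k, a) \<in> W" for i k a
    using that Pj by (auto simp: W_def)
  have low: "(i, k, a) \<in> q' \<longleftrightarrow> (i, k, a) \<in> q \<or> (i, k, a) \<in> W" if "i < j" for i k a
    using that by (auto simp: q'_eq)
  have atj: "(j, k, a) \<in> q' \<longleftrightarrow> (k, a) \<in> L" for k a
    using qL Wlow[of j k a] by (auto simp: q'_eq)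
  have high: "(i, k, a) \<in> q' \<longleftrightarrow> (i, k, a) \<in> q" if "j < i" for i k a
    using that Wlow[of i k a] by (auto simp: q'_eq)
  \<comment> \<open>stamps that meet or touch belong to zeros that are equal or adjacent, hence equal\<close>
  have stamps: "m = m'"
    if m: "(m, 0) \<in> L" "(m', 0) \<in> L" and "(i, k, a) \<in> translate m (P j)"
      "(i, k \<odot> d, b) \<in> translate m' (P j)" "d \<in> insert \<epsilon> (D i)" for m m' i k a b d
  proof (rule ccontr)
    assume "m \<noteq> m'"
    have w: "(i, iv m \<odot> k, a) \<in> P j" "(i, iv m' \<odot> (k \<odot> d), b) \<in> P j" using that by auto
    then have "iv m \<odot> k \<odot> d \<odot> iv (iv m' \<odot> (k \<odot> d)) \<in> insert \<epsilon> (D j)"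
      using P(9) that(5) Pj[OF w(1)] unfolding stamps_separated_def by blast
    then have "iv m \<odot> m' \<in> insert \<epsilon> (D j)"
      by (simp add: inverse_distrib_swap assoc)
    moreover have "iv m \<odot> m' \<noteq> \<epsilon>"
      using \<open>m \<noteq> m'\<close> by (metis iv_move right_neutral)
    ultimately have "iv m \<odot> m' \<in> D j" by blast
    then have "(m \<odot> (iv m \<odot> m'), 0) \<notin> L" using Lprop m by blast
    then show False using m by simp
  qed
  have qW: False if "(i, k, a) \<in> q" "(i, k \<odot> d, b) \<in> W" "d \<in> insert \<epsilon> (D i)" for i k a b d
  proof -
    from that(2) obtain m where m: "(m, 0) \<in> L" "\<And>a. (j, m, a) \<notin> q"
      "(i, k \<odot> d, b) \<in> translate m (P j)" by (auto simp: W_def)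
    have "i < j" using Wlow that by blast
    then have "(\<exists>m b. (j, m, 0) \<in> q \<and> (i, k, b) \<in> translate m (P j)) \<or>
      (\<forall>m b. \<forall>d\<in>insert \<epsilon> (D i). (i, k \<odot> d, b) \<in> translate m (P j) \<longrightarrow> (\<exists>c. (j, m, c) \<in> q))"
      using shq that(1) \<open>j < n\<close> unfolding shielded_def by blast
    then show False
    proof
      assume "\<exists>m b. (j, m, 0) \<in> q \<and> (i, k, b) \<in> translate m (P j)"
      then obtain m0 c where 1: "(j, m0, 0) \<in> q" "(i, k, c) \<in> translate m0 (P j)" by blast
      then have "m0 = m" using stamps[OF qL m(1) _ m(3) that(3)] by blast
      then show False using 1 m(2) by blast
    next
      assume "\<forall>m b. \<forall>d\<in>insert \<epsilon> (D i). (i, k \<odot> d, b) \<in> translate m (P j) \<longrightarrow> (\<exists>c. (j, m, c) \<in> q)"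
      then show False using that(3) m(2,3) by blast
    qed
  qed
  have WW: "\<exists>m. (i, k, a) \<in> translate m (P j) \<and> (i, k \<odot> d, b) \<in> translate m (P j)"
    if "(i, k, a) \<in> W" "(i, k \<odot> d, b) \<in> W" "d \<in> insert \<epsilon> (D i)" for i k a b d
    using that stamps unfolding W_def by blast
  have prT: "proper D j (translate m (P j))" for m using P(7) by (rule proper_translate)
  have pr: "proper D n q'"
    unfolding proper_def
  proof (intro allI impI conjI ballI)
    fix i k a b assume h: "i < n" "(i, k, a) \<in> q'" "(i, k, b) \<in> q'"
    consider "i < j" | "i = j" | "j < i" by linarith
    then show "a = b"
    proof cases
      case 1
      have "a = b" if "(i, k, a) \<in> q" "(i, k, b) \<in> q" using q(1) h that unfolding proper_def by blast
      moreover have "a = b" if "(i, k, a) \<in> W" "(i, k, b) \<in> W"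
        using WW[OF that(1), of \<epsilon> b] that prT 1 unfolding proper_def by auto
      moreover have "\<not> ((i, k, a) \<in> q \<and> (i, k, b) \<in> W)" "\<not> ((i, k, b) \<in> q \<and> (i, k, a) \<in> W)"
        using qW[of i k _ \<epsilon>] by auto
      ultimately show ?thesis using h low[OF 1] by blast
    next
      case 2
      then show ?thesis using h Lfun by (simp add: atj)
    next
      case 3
      then show ?thesis using h q(1) unfolding proper_def high[OF 3] by blast
    qed
  next
    fix i k a d assume h: "i < n" "(i, k, a) \<in> q'" "d \<in> D i"
    show "(i, k \<odot> d, a) \<notin> q'"
    proof
      assume h': "(i, k \<odot> d, a) \<in> q'"
      consider "i < j" | "i = j" | "j < i" by linarith
      then show False
      proof cases
        case 1
        have iv: "iv d \<in> D i" using level_dataD(3)[OF data'] h by blast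
        have "\<not> ((i, k, a) \<in> q \<and> (i, k \<odot> d, a) \<in> q)" using q(1) h unfolding proper_def by blast
        moreover have "\<not> ((i, k, a) \<in> W \<and> (i, k \<odot> d, a) \<in> W)"
          using WW[of i k a d a] prT 1 h unfolding proper_def by blast
        moreover have "\<not> ((i, k, a) \<in> q \<and> (i, k \<odot> d, a) \<in> W)" using qW h by blast
        moreover have "\<not> ((i, k \<odot> d, a) \<in> q \<and> (i, k, a) \<in> W)"
          using qW[of i "k \<odot> d" a "iv d" a] iv by (auto simp: assoc)
        ultimately show False using h h' low[OF 1] by blast
      next
        case 2
        then show False using h h' Lprop by (simp add: atj)
      next
        case 3
        then show False using h h' q(1) unfolding proper_def high[OF 3] by blast
      qed
    qed
  qed
  have Wsc: "self_contained D P j W"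
    unfolding W_def using P(8) by (intro self_contained_Union) (auto intro: self_contained_translate)
  have tot: "total i q'" if "i < n" "j \<le> i" for i
  proof (cases "i = j")
    case True
    then show ?thesis using Ltot by (simp add: total_def atj)
  next
    case False
    then have "j < i" using that by simp
    then show ?thesis using q(3) that by (simp add: total_def high)
  qed
  have "witnessed D n q'"
    unfolding witnessed_def
  proof (intro allI impI)
    fix i k a v assume h: "i < n" "(i, k, a) \<in> q'" "v < a"
    consider "i < j" | "i = j" | "j < i" by linarith
    then show "\<exists>d\<in>D i. (i, k \<odot> d, v) \<in> q'"
    proof cases
      case 1
      then have "(\<exists>d\<in>D i. (i, k \<odot> d, v) \<in> q) \<or> (\<exists>d\<in>D i. (i, k \<odot> d, v) \<in> W)"
        using h low[OF 1] wq Wsc unfolding self_contained_def witnessed_def by blast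
      then show ?thesis using low[OF 1] by blast
    next
      case 2
      then show ?thesis using h L unfolding grundy_def by (simp add: atj)
    next
      case 3
      then show ?thesis using h wq unfolding witnessed_def high[OF 3] by blast
    qed
  qed
  moreover have "stamped P n q'"
    unfolding stamped_def
  proof (intro allI impI)
    fix i m assume h: "i < n" "(i, m, 0) \<in> q'"
    consider "i < j" | "i = j" | "j < i" by linarith
    then show "translate m (P i) \<subseteq> q'"
    proof cases
      case 1
      then have "translate m (P i) \<subseteq> q \<or> translate m (P i) \<subseteq> W"
        using h low[OF 1] sq Wsc unfolding self_contained_def stamped_def by blast
      then show ?thesis by (auto simp: q'_eq)
    next
      case 2
      then have "(m, 0) \<in> L" using h by (simp add: atj)
      then have "translate m (P j) \<subseteq> q \<or> translate m (P j) \<subseteq> W"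
        using old unfolding W_def by blast
      then show ?thesis unfolding 2 q'_eq by blast
    next
      case 3
      then have "translate m (P i) \<subseteq> q" using h sq unfolding stamped_def high[OF 3] by blast
      then show ?thesis by (auto simp: q'_eq)
    qed
  qed
  moreover have "shielded D P n q'"
    unfolding shielded_def
  proof (intro allI impI)
    fix i' i k a assume h: "i' < n" "i < i'" "(i, k, a) \<in> q'"
    let ?goal = "\<lambda>q. (\<exists>m b. (i', m, 0) \<in> q \<and> (i, k, b) \<in> translate m (P i')) \<or>
      (\<forall>m b. \<forall>d\<in>insert \<epsilon> (D i). (i, k \<odot> d, b) \<in> translate m (P i') \<longrightarrow> (\<exists>c. (i', m, c) \<in> q))"
    show "?goal q'"
    proof (cases "j \<le> i'")
      case True
      then show ?thesis using tot h unfolding total_def by blast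
    next
      case False
      then have "i' < j" by simp
      have "?goal q \<or> ?goal W"
      proof (cases "(i, k, a) \<in> q")
        case True
        then show ?thesis using shq h unfolding shielded_def by blast
      next
        case False
        then have "(i, k, a) \<in> W" using h low \<open>i' < j\<close> by simp
        then show ?thesis using Wsc h \<open>i' < j\<close> unfolding self_contained_def shielded_def by blast
      qed
      then show ?thesis using low[OF \<open>i' < j\<close>] by blast
    qed
  qed
  ultimately show ?thesis using pr tot by (simp add: self_contained_def)
qed

lemma complete_correct:
  assumes data: "\<And>i. i < n \<Longrightarrow> level_data D P i" and A: "\<And>i. i < n \<Longrightarrow> schedule (D i) (A i)"
  shows "j \<le> n \<Longrightarrow> proper D n q \<Longrightarrow> self_contained D P n q \<Longrightarrow> (\<And>i. j \<le> i \<Longrightarrow> i < n \<Longrightarrow> total i q) \<Longrightarrow>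
    legal D P n (complete D P A j q)"
proof (induction j arbitrary: q)
  case 0
  then show ?case by (simp add: legal_def self_contained_def)
next
  case (Suc j)
  then have "j < n" by simp
  have "total i q" if "j < i" "i < n" for i using Suc.prems that by simp
  then have "proper D n (complete_layer D P A j q) \<and>
    self_contained D P n (complete_layer D P A j q) \<and>
    (\<forall>i<n. j \<le> i \<longrightarrow> total i (complete_layer D P A j q))"
    using data A \<open>j < n\<close> Suc.prems(2,3) by (intro complete_layer_correct) auto
  then have "proper D n (complete_layer D P A j q)" "self_contained D P n (complete_layer D P A j q)"
    "\<And>i. j \<le> i \<Longrightarrow> i < n \<Longrightarrow> total i (complete_layer D P A j q)"
    by blast+
  then show ?case using Suc.IH \<open>j < n\<close> by simp
qed

lemma legal_complete_empty:
  assumes "\<And>i. i < n \<Longrightarrow> level_data D P i" and "\<And>i. i < n \<Longrightarrow> schedule (D i) (A i)"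
  shows "legal D P n (complete D P A n {})"
  by (rule complete_correct[OF assms])
    (auto simp: proper_def self_contained_def witnessed_def stamped_def shielded_def)

lemma complete_layer_translate:
  "complete_layer D P (\<lambda>i t. {k. g \<odot> k \<in> A i t}) j (translate (iv g) q) =
    translate (iv g) (complete_layer D P A j q)"
proof -
  let ?L = "greedy_colouring (D j) (A j) {(k, a). (j, k, a) \<in> q}"
  let ?L' = "greedy_colouring (D j) (\<lambda>t. {k. g \<odot> k \<in> A j t}) {(k, a). (j, k, a) \<in> translate (iv g) q}"
  have L: "(k, a) \<in> ?L' \<longleftrightarrow> (g \<odot> k, a) \<in> ?L" for k a
    using greedy_translate[of k a "D j" g "A j" "{(k, a). (j, k, a) \<in> q}"]
    by (simp add: greedy_colouring_def)
  show ?thesis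
    unfolding complete_layer_def Let_def set_eq_iff
  proof (intro allI)
    fix t :: "nat \<times> 'g \<times> nat"
    obtain i k a where t: "t = (i, k, a)" by (cases t)
    have "(\<exists>m. (g \<odot> m, 0) \<in> ?L \<and> (i, iv m \<odot> k, a) \<in> P j) \<longleftrightarrow>
        (\<exists>m. (m, 0) \<in> ?L \<and> (i, iv m \<odot> (g \<odot> k), a) \<in> P j)" (is "?l \<longleftrightarrow> ?r")
    proof
      assume ?l
      then obtain m where "(g \<odot> m, 0) \<in> ?L \<and> (i, iv m \<odot> k, a) \<in> P j" by blast
      then show ?r by (intro exI[of _ "g \<odot> m"]) (simp add: inverse_distrib_swap assoc)
    next
      assume ?r
      then obtain m where "(m, 0) \<in> ?L \<and> (i, iv m \<odot> (g \<odot> k), a) \<in> P j" by blast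
      then show ?l by (intro exI[of _ "iv g \<odot> m"]) (simp add: inverse_distrib_swap assoc)
    qed
    then show "(t \<in> translate (iv g) q \<union> {(i, k, a). i = j \<and> (k, a) \<in> ?L'} \<union>
        (\<Union>m\<in>{m. (m, 0) \<in> ?L'}. translate m (P j))) =
      (t \<in> translate (iv g) (q \<union> {(i, k, a). i = j \<and> (k, a) \<in> ?L} \<union>
        (\<Union>m\<in>{m. (m, 0) \<in> ?L}. translate m (P j))))"
      unfolding t Un_iff UN_iff mem_Collect_eq case_prod_conv Bex_def L
      unfolding mem_translate inverse_inverse Un_iff UN_iff mem_Collect_eq case_prod_conv Bex_def
      by simp
  qed
qed

lemma complete_translate:
  "complete D P (\<lambda>i t. {k. g \<odot> k \<in> A i t}) n (translate (iv g) q) =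
    translate (iv g) (complete D P A n q)"
  by (induction n arbitrary: q) (simp_all add: complete_layer_translate)

section \<open>The shift action and random legal configurations\<close>

definition shift :: "'g \<Rightarrow> (nat \<times> 'g \<times> nat \<Rightarrow> bool) \<Rightarrow> (nat \<times> 'g \<times> nat \<Rightarrow> bool)"
  where "shift g x = (\<lambda>(i, k, a). x (i, iv g \<odot> k, a))"

lemma Collect_shift: "Collect (shift g x) = translate g (Collect x)"
  by (auto simp: shift_def translate_def)

lemma shift_one [simp]: "shift \<epsilon> x = x"
  by (auto simp: shift_def)

lemma shift_mult: "shift (g \<odot> h) x = shift g (shift h x)"
  by (auto simp: shift_def inverse_distrib_swap assoc)

lemma shift_iv [simp]: "shift (iv g) (shift g x) = x" "shift g (shift (iv g) x) = x"
  by (simp_all add: shift_mult[symmetric])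

lemma continuous_shift: "continuous_on UNIV (shift g)"
proof (rule continuous_on_coordinatewise_then_product)
  fix t :: "nat \<times> 'g \<times> nat"
  show "continuous_on UNIV (\<lambda>x. shift g x t)"
    by (cases t) (simp add: shift_def)
qed

text \<open>
  In a legal configuration the colours are bounded, so each existential quantifier can be restricted to a finite set.
\<close>

lemma legal_iff_local:
  assumes "\<And>i. i < n \<Longrightarrow> finite (D i)"
  shows "legal D P n q \<longleftrightarrow> proper D n q \<and> witnessed D n q \<and> stamped P n q \<and>
    (\<forall>i<n. \<forall>k. \<exists>a\<in>{..card (D i)}. (i, k, a) \<in> q)"
  unfolding legal_def total_def using colour_le_card[of D n q] assms by (meson atMost_iff)

lemma closed_Collect_bex_finite:
  assumes "finite A" "\<And>a. a \<in> A \<Longrightarrow> closed {x. P x a}"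
  shows "closed {x. \<exists>a\<in>A. P x a}"
proof -
  have "{x. \<exists>a\<in>A. P x a} = (\<Union>a\<in>A. {x. P x a})" by auto
  then show ?thesis using assms by (simp add: closed_UN)
qed

lemma closed_Collect_ball:
  assumes "\<And>a. a \<in> A \<Longrightarrow> closed {x. P x a}"
  shows "closed {x. \<forall>a\<in>A. P x a}"
proof -
  have "{x. \<forall>a\<in>A. P x a} = (\<Inter>a\<in>A. {x. P x a})" by auto
  then show ?thesis using assms by auto
qed

text \<open>
  Boundedness of the colours turns totality of a layer, an infinite disjunction, into a closed condition.
\<close>

lemma closed_legal:
  assumes fin: "\<And>i. i < n \<Longrightarrow> finite (D i)"
  shows "closed {x. legal D P n (Collect x)}"
proof -
  have [simp]: "closed {x :: nat \<times> 'g \<times> nat \<Rightarrow> bool. x t}"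
    "open {x :: nat \<times> 'g \<times> nat \<Rightarrow> bool. x t}" for t
    by (rule clopen_coordinate)+
  have neg: "closed {x :: nat \<times> 'g \<times> nat \<Rightarrow> bool. \<not> x t}" for t
    by (simp add: closed_Collect_neg)
  have 1: "closed {x. proper D n (Collect x)}"
    unfolding proper_def mem_Collect_eq
    by (intro closed_Collect_all closed_Collect_imp closed_Collect_conj closed_Collect_ball neg
        open_Collect_const closed_Collect_const) simp_all
  have 2: "closed {x. witnessed D n (Collect x)}"
  proof -
    have "closed {x :: nat \<times> 'g \<times> nat \<Rightarrow> bool. i < n \<longrightarrow> (\<forall>k a. x (i, k, a) \<longrightarrow> (\<forall>v<a. \<exists>d\<in>D i. x (i, k \<odot> d, v)))}" for i
    proof (cases "i < n")
      case True
      then show ?thesis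
        by (intro closed_Collect_all closed_Collect_imp open_Collect_const
            closed_Collect_bex_finite fin) simp_all
    qed simp
    then show ?thesis unfolding witnessed_def mem_Collect_eq by (intro closed_Collect_all)
  qed
  have 3: "closed {x. stamped P n (Collect x)}"
    unfolding stamped_def mem_Collect_eq subset_eq
    by (intro closed_Collect_all closed_Collect_imp closed_Collect_ball open_Collect_const) simp_all
  have 4: "closed {x :: nat \<times> 'g \<times> nat \<Rightarrow> bool. \<forall>i<n. \<forall>k. \<exists>a\<in>{..card (D i)}. x (i, k, a)}"
    by (intro closed_Collect_all closed_Collect_imp open_Collect_const closed_Collect_bex_finite) simp_all
  have "legal D P n q \<longleftrightarrow> proper D n q \<and> witnessed D n q \<and> stamped P n q \<and>
    (\<forall>i<n. \<forall>k. \<exists>a\<in>{..card (D i)}. (i, k, a) \<in> q)" for q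
    by (rule legal_iff_local) (rule fin)
  then show ?thesis
    by (simp only: mem_Collect_eq) (intro closed_Collect_conj 1 2 3 4)
qed

text \<open>
  Time \<open>t\<close> encodes a mesh \<open>1 / N\<close> and a position \<open>z\<close>. A vertex acts at that time if its label lies in the cell number \<open>z\<close> of
  the mesh and the labels of its neighbours do not. Neighbours never act simultaneously, and a fine enough mesh separates any finite
  number of distinct labels.
\<close>

definition active :: "'g set \<Rightarrow> ('g \<Rightarrow> real) \<Rightarrow> nat \<Rightarrow> 'g set"
  where "active E u t = {k. case from_nat t :: nat \<times> int of (N, z) \<Rightarrow>
    \<lfloor>real N * u k\<rfloor> = z \<and> (\<forall>d\<in>E. \<lfloor>real N * u (k \<odot> d)\<rfloor> \<noteq> z)}"

text \<open>
  Distinct labels make every vertex act at some time: take \<open>N\<close> with \<open>1 / N\<close> below the distance of its label to those of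
  its neighbours.
\<close>

lemma schedule_active:
  assumes "inj u" "finite E" "\<epsilon> \<notin> E"
  shows "schedule E (active E u)"
  unfolding schedule_def
proof (intro conjI allI ballI)
  fix t k d assume "k \<in> active E u t" "d \<in> E"
  then show "k \<odot> d \<notin> active E u t"
    by (auto simp: active_def split: prod.splits)
next
  fix k
  have "\<forall>\<^sub>F N in sequentially. \<lfloor>real N * u (k \<odot> d)\<rfloor> \<noteq> \<lfloor>real N * u k\<rfloor>" if "d \<in> E" for d
  proof -
    have "k \<odot> d \<noteq> k" using that assms(3) by (metis left_cancel right_neutral)
    then have "0 < \<bar>u (k \<odot> d) - u k\<bar>" using assms(1) by (auto simp: inj_def)
    then obtain M where M: "1 < real M * \<bar>u (k \<odot> d) - u k\<bar>" using reals_Archimedean3 by blast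
    have "\<lfloor>real N * u (k \<odot> d)\<rfloor> \<noteq> \<lfloor>real N * u k\<rfloor>" if "M \<le> N" for N
    proof
      assume "\<lfloor>real N * u (k \<odot> d)\<rfloor> = \<lfloor>real N * u k\<rfloor>"
      then have "\<bar>real N * u (k \<odot> d) - real N * u k\<bar> < 1" by linarith
      also have "real N * u (k \<odot> d) - real N * u k = real N * (u (k \<odot> d) - u k)"
        by (simp add: algebra_simps)
      finally have "real N * \<bar>u (k \<odot> d) - u k\<bar> < 1" by (simp add: abs_mult)
      moreover have "real M * \<bar>u (k \<odot> d) - u k\<bar> \<le> real N * \<bar>u (k \<odot> d) - u k\<bar>"
        using that by (intro mult_right_mono) auto
      ultimately show False using M by linarith
    qed
    then show ?thesis by (rule eventually_sequentiallyI)
  qed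
  then have "\<forall>\<^sub>F N in sequentially. \<forall>d\<in>E. \<lfloor>real N * u (k \<odot> d)\<rfloor> \<noteq> \<lfloor>real N * u k\<rfloor>"
    using \<open>finite E\<close> by (simp add: eventually_ball_finite)
  then obtain N where "\<forall>d\<in>E. \<lfloor>real N * u (k \<odot> d)\<rfloor> \<noteq> \<lfloor>real N * u k\<rfloor>"
    by (auto simp: eventually_sequentially)
  then have "k \<in> active E u (to_nat (N, \<lfloor>real N * u k\<rfloor>))" by (simp add: active_def)
  then show "\<exists>t. k \<in> active E u t" by blast
qed

definition random_config ::
    "(nat \<Rightarrow> 'g set) \<Rightarrow> (nat \<Rightarrow> (nat \<times> 'g \<times> nat) set) \<Rightarrow> nat \<Rightarrow> ('g \<Rightarrow> real) \<Rightarrow> (nat \<times> 'g \<times> nat) set"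
  where "random_config D P n u = complete D P (\<lambda>i. active (D i) u) n {}"

lemma random_config_shift:
  "random_config D P n (\<lambda>k. u (g \<odot> k)) = translate (iv g) (random_config D P n u)"
proof -
  have "active E (\<lambda>k. u (g \<odot> k)) = (\<lambda>t. {k. g \<odot> k \<in> active E u t})" for E
    by (simp add: active_def assoc fun_eq_iff)
  moreover have "translate (iv g) {} = {}" by (auto simp: translate_def)
  ultimately have "random_config D P n (\<lambda>k. u (g \<odot> k)) =
    complete D P (\<lambda>i t. {k. g \<odot> k \<in> active (D i) u t}) n (translate (iv g) {})"
    by (simp add: random_config_def)
  also have "\<dots> = translate (iv g) (random_config D P n u)"
    unfolding random_config_def by (rule complete_translate)
  finally show ?thesis .
qed

lemma measurable_active: "Measurable.pred iid_labels (\<lambda>u. k \<in> active E u t)"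
proof -
  obtain N z where "(from_nat t :: nat \<times> int) = (N, z)" by (cases "from_nat t :: nat \<times> int") auto
  then have "(\<lambda>u. k \<in> active E u t) = (\<lambda>u. \<lfloor>real N * u k\<rfloor> = z \<and> (\<forall>d\<in>E. \<lfloor>real N * u (k \<odot> d)\<rfloor> \<noteq> z))"
    by (simp add: active_def)
  also have "Measurable.pred iid_labels \<dots>"
    by (intro pred_intros_logic pred_intros_countable_bounded countableI_type) measurable
  finally show ?thesis .
qed

lemma measurable_greedy:
  assumes "\<And>k t. Measurable.pred M (\<lambda>u. k \<in> A u t)" "\<And>k a. Measurable.pred M (\<lambda>u. (k, a) \<in> R u)"
  shows "Measurable.pred M (\<lambda>u. (k, a) \<in> greedy E (A u) (R u) t)"
proof (induction t arbitrary: k a)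
  case 0
  then show ?case using assms by simp
next
  case (Suc t)
  note [measurable] = Suc assms
  show ?case
    unfolding greedy.simps Un_iff mem_Collect_eq case_prod_conv
    by (intro pred_intros_logic pred_intros_countable_bounded pred_intros_countable countableI_type Suc assms)
      simp_all
qed

lemma measurable_complete_layer:
  assumes A: "\<And>i k t. Measurable.pred M (\<lambda>u. k \<in> A u i t)"
    and q: "\<And>i k a. Measurable.pred M (\<lambda>u. (i, k, a) \<in> q u)"
  shows "Measurable.pred M (\<lambda>u. (i, k, a) \<in> complete_layer D P (A u) j (q u))"
proof -
  have L: "Measurable.pred M (\<lambda>u. (k, a) \<in> greedy_colouring (D j) (A u j) {(k, a). (j, k, a) \<in> q u})" for k a
    unfolding greedy_colouring_def UN_iff
    by (intro pred_intros_countable_bounded countableI_type measurable_greedy A) (simp add: q)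
  show ?thesis
    unfolding complete_layer_def Let_def Un_iff mem_Collect_eq case_prod_conv UN_iff Bex_def mem_translate
    by (intro pred_intros_logic pred_intros_countable L q measurable_const) simp_all
qed

lemma measurable_random_config: "Measurable.pred iid_labels (\<lambda>u. t \<in> random_config D P n u)"
proof -
  have "Measurable.pred iid_labels (\<lambda>u. (i, k, a) \<in> complete D P (\<lambda>i. active (D i) u) n (q u))"
    if "\<And>i k a. Measurable.pred iid_labels (\<lambda>u. (i, k, a) \<in> q u)" for q i k a
    using that
    by (induction n arbitrary: q) (simp_all add: measurable_complete_layer measurable_active)
  from this[of "\<lambda>_. {}"] show ?thesis by (cases t) (simp add: random_config_def)
qed

text \<open>
  Almost surely all labels are distinct, and then the completion of the empty patch is legal. Equivariance
  of the completion transports the permutation invariance of the product measure.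
\<close>

lemma exists_invariant_measure_on_legal:
  assumes data: "\<And>i. i < n \<Longrightarrow> level_data D P i"
  shows "\<exists>\<nu>. prob_space \<nu> \<and> sets \<nu> = sets borel \<and> (\<forall>g. distr \<nu> borel (shift g) = \<nu>) \<and>
    emeasure \<nu> {x. legal D P n (Collect x)} = 1"
proof -
  define X where "X u = (\<lambda>t. t \<in> random_config D P n u)" for u
  interpret prob_space iid_labels by (rule prob_space_iid_labels)
  have mX [measurable]: "X \<in> measurable iid_labels borel"
  proof -
    have "(\<lambda>u. X u t) \<in> measurable iid_labels borel" for t
    proof (rule measurableI)
      fix B :: "bool set"
      have m: "Measurable.pred iid_labels (\<lambda>u. X u t)"
        unfolding X_def by (rule measurable_random_config)
      then show "(\<lambda>u. X u t) -` B \<inter> space iid_labels \<in> events"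
        by (rule measurable_sets) simp
    qed simp
    then have "X \<in> measurable iid_labels (Pi\<^sub>M UNIV (\<lambda>_. borel))"
      by (intro measurable_PiM_single') auto
    then show ?thesis by (simp cong: measurable_cong_sets add: sets_PiM_equal_borel)
  qed
  have closed: "closed {x. legal D P n (Collect x)}"
    using level_dataD(1)[OF data] by (rule closed_legal)
  define \<nu> where "\<nu> = distr iid_labels borel X"
  have p: "prob_space \<nu>" unfolding \<nu>_def using mX by (rule prob_space_distr)
  have mS: "shift g \<in> borel_measurable borel" for g
    using continuous_shift by (rule borel_measurable_continuous_onI)
  have inv: "distr \<nu> borel (shift g) = \<nu>" for g
  proof -
    have perm: "distr iid_labels iid_labels (\<lambda>u k. u (iv g \<odot> k)) = iid_labels"
      by (rule iid_labels_permute) (metis injI left_cancel)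
    have mP: "(\<lambda>u k. u (iv g \<odot> k)) \<in> measurable iid_labels iid_labels"
      unfolding iid_labels_def
      by (intro measurable_PiM_single') (auto simp: measurable_component_singleton)
    have "distr \<nu> borel (shift g) = distr iid_labels borel (shift g \<circ> X)"
      unfolding \<nu>_def using mS mX by (rule distr_distr)
    also have "shift g \<circ> X = X \<circ> (\<lambda>u k. u (iv g \<odot> k))"
      using random_config_shift[of D P n _ "iv g"]
      by (auto simp: X_def shift_def fun_eq_iff)
    also have "distr iid_labels borel (X \<circ> (\<lambda>u k. u (iv g \<odot> k))) =
        distr (distr iid_labels iid_labels (\<lambda>u k. u (iv g \<odot> k))) borel X"
      using mX mP by (rule distr_distr[symmetric])
    finally show ?thesis by (simp add: perm \<nu>_def)
  qed
  have "AE u in iid_labels. X u \<in> {x. legal D P n (Collect x)}"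
    using iid_labels_inj
  proof eventually_elim
    case (elim u)
    have "schedule (D i) (active (D i) u)" if "i < n" for i
      using elim level_dataD(1,2)[OF data[OF that]] by (rule schedule_active)
    then have "legal D P n (random_config D P n u)"
      unfolding random_config_def using data by (intro legal_complete_empty)
    then show ?case by (simp add: X_def)
  qed
  then have "AE x in \<nu>. x \<in> {x. legal D P n (Collect x)}"
    unfolding \<nu>_def using mX closed by (subst AE_distr_iff) (auto intro: borel_closed)
  then have "emeasure \<nu> {x. legal D P n (Collect x)} = 1"
    using p closed by (intro prob_space.emeasure_eq_1_AE) (auto simp: \<nu>_def)
  with p inv show ?thesis by (auto simp: \<nu>_def)
qed

section \<open>The limit set is minimal, free and perfect\<close>

definition limit_set ::
    "(nat \<Rightarrow> 'g set) \<Rightarrow> (nat \<Rightarrow> (nat \<times> 'g \<times> nat) set) \<Rightarrow> (nat \<times> 'g \<times> nat \<Rightarrow> bool) set"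
  where "limit_set D P = (\<Inter>n. {x. legal D P n (Collect x)})"

lemma limit_set_legal: "x \<in> limit_set D P \<Longrightarrow> legal D P n (Collect x)"
  by (simp add: limit_set_def)

lemma shift_limit_set: "x \<in> limit_set D P \<Longrightarrow> shift g x \<in> limit_set D P"
  by (simp add: limit_set_def Collect_shift legal_translate)

text \<open>
  A cylinder around \<open>y\<close> is given by a pattern on finitely many layers and group elements. For large \<open>n\<close> it occurs in
  the stamp \<open>P n\<close>, and that stamp occurs in \<open>x\<close> at any zero of layer \<open>n\<close>.
\<close>

lemma limit_set_minimal:
  assumes data: "\<And>n. level_data D P n" and x: "x \<in> limit_set D P" and y: "y \<in> limit_set D P"
    and U: "open U" "y \<in> U"
  shows "\<exists>g. shift g x \<in> U"
proof -
  obtain F where F: "finite F" "cylinder F y \<subseteq> U" using open_contains_cylinder[OF U] by blast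
  have "finite ((\<lambda>(i, k, a). max i (to_nat k)) ` F)" using F(1) by simp
  then obtain n where "(\<lambda>(i, k, a). max i (to_nat k)) ` F \<subseteq> {..<n}" using finite_nat_iff_bounded by blast
  then have n: "i < n" "to_nat k < n" if "(i, k, a) \<in> F" for i k a using that by fastforce+
  have leg_y: "legal D P n (Collect y)" and leg_x: "legal D P (Suc n) (Collect x)"
    using x y limit_set_legal by blast+
  obtain u where u: "\<And>i k a. i < n \<Longrightarrow> to_nat k < n \<Longrightarrow> y (i, k, a) \<Longrightarrow> (i, u \<odot> k, a) \<in> P n"
    using level_dataD(10)[OF data] leg_y unfolding universal_def by blast
  obtain m where m: "x (n, m, 0)"
  proof -
    obtain a where a: "x (n, \<epsilon>, a)" using leg_x by (auto simp: legal_def total_def)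
    show thesis
    proof (cases "a = 0")
      case True
      then show thesis using a that by blast
    next
      case False
      then show thesis using a leg_x that unfolding legal_def witnessed_def by blast
    qed
  qed
  have st: "translate m (P n) \<subseteq> Collect x"
    using leg_x m unfolding legal_def stamped_def by blast
  have copy: "x (i, m \<odot> u \<odot> k, a)" if "i < n" "to_nat k < n" "y (i, k, a)" for i k a
  proof -
    have "(i, m \<odot> (u \<odot> k), a) \<in> translate m (P n)" using u[OF that] by simp
    with st have "(i, m \<odot> (u \<odot> k), a) \<in> Collect x" by (rule subsetD)
    then show ?thesis by (simp add: assoc)
  qed
  have "shift (iv (m \<odot> u)) x \<in> cylinder F y"
    unfolding cylinder_def
  proof (intro CollectI ballI)
    fix t assume "t \<in> F"
    obtain i k a where t: "t = (i, k, a)" by (cases t)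
    note n = n[OF \<open>t \<in> F\<close>[unfolded t]]
    have "x (i, m \<odot> u \<odot> k, a) \<longleftrightarrow> y (i, k, a)"
    proof
      assume xa: "x (i, m \<odot> u \<odot> k, a)"
      obtain b where b: "y (i, k, b)" using leg_y n by (auto simp: legal_def total_def)
      then have "x (i, m \<odot> u \<odot> k, b)" using copy n by blast
      then have "a = b" using xa leg_x n less_SucI unfolding legal_def proper_def by blast
      then show "y (i, k, a)" using b by simp
    qed (use copy n in blast)
    then show "shift (iv (m \<odot> u)) x t = y t" by (simp add: shift_def t del: inverse_distrib_swap)
  qed
  then show ?thesis using F(2) by blast
qed

text \<open>
  A fixed point of \<open>g\<close> gives the unit and \<open>g\<^sup>-\<^sup>1\<close> the same colour in every layer, also in one where they are adjacent.
\<close>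

lemma limit_set_free:
  assumes data: "\<And>n. level_data D P n" and x: "x \<in> limit_set D P" and "g \<noteq> \<epsilon>"
  shows "shift g x \<noteq> x"
proof
  assume fixed: "shift g x = x"
  let ?n = "to_nat (iv g)"
  have "iv g \<noteq> \<epsilon>" using \<open>g \<noteq> \<epsilon>\<close> by (metis inverse_inverse inverse_neutral)
  then have D: "iv g \<in> D ?n" using level_dataD(4)[OF data, of ?n] by simp
  have leg: "legal D P (Suc ?n) (Collect x)" using x by (rule limit_set_legal)
  then obtain a where a: "x (?n, \<epsilon>, a)" by (auto simp: legal_def total_def)
  then have "x (?n, iv g, a)" using fun_cong[OF fixed, of "(?n, \<epsilon>, a)"] by (simp add: shift_def)
  moreover have "\<not> x (?n, \<epsilon> \<odot> iv g, a)" using leg a D unfolding legal_def proper_def by blast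
  ultimately show False by simp
qed

lemma closed_limit_set:
  assumes data: "\<And>n. level_data D P n"
  shows "closed (limit_set D P)"
  unfolding limit_set_def
  by (intro closed_INT ballI closed_legal level_dataD(1)[OF data])

text \<open>
  If \<open>x\<close> were isolated, by minimality translates of its isolating neighbourhood would cover the limit set. By compactness
  finitely many suffice, so the limit set would be finite, although free orbits are infinite.
\<close>

lemma limit_set_perfect:
  assumes data: "\<And>n. level_data D P n" and x: "x \<in> limit_set D P" and U: "open U" "x \<in> U"
  shows "\<exists>y\<in>limit_set D P. y \<in> U \<and> y \<noteq> x"
proof (rule ccontr)
  let ?Z = "limit_set D P"
  assume iso: "\<not> (\<exists>y\<in>?Z. y \<in> U \<and> y \<noteq> x)"
  have opn: "open (shift g -` U)" for g using U(1) continuous_shift by (rule open_vimage)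
  have "compact ?Z" using closed_limit_set[OF data] by (rule compact_if_closed)
  moreover have "?Z \<subseteq> (\<Union>g\<in>UNIV. shift g -` U)"
    using limit_set_minimal[OF data _ x U] by blast
  ultimately obtain C where C: "finite C" "?Z \<subseteq> (\<Union>g\<in>C. shift g -` U)"
    using opn by (elim compactE_image) auto
  have "?Z \<subseteq> (\<lambda>g. shift (iv g) x) ` C"
  proof
    fix y assume y: "y \<in> ?Z"
    then obtain g where g: "g \<in> C" "shift g y \<in> U" using C by blast
    then have "shift g y = x" using iso shift_limit_set[OF y] by blast
    then have "y = shift (iv g) x" by auto
    then show "y \<in> (\<lambda>g. shift (iv g) x) ` C" using g by blast
  qed
  then have "finite ?Z" using C(1) by (meson finite_imageI finite_subset)
  then have "finite (range (\<lambda>g. shift g x))"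
    by (rule rev_finite_subset) (use shift_limit_set[OF x] in blast)
  moreover have "inj (\<lambda>g. shift g x)"
  proof (rule injI)
    fix g h assume "shift g x = shift h x"
    then have "shift (iv h \<odot> g) x = x" by (simp add: shift_mult)
    then have "iv h \<odot> g = \<epsilon>" using limit_set_free[OF data x] by blast
    then show "g = h" by (simp add: iv_move)
  qed
  ultimately show False using infinite_group by (simp add: finite_image_iff)
qed

text \<open>
  The shift on the limit set, transported to the Cantor space along a homeomorphism.
\<close>

lemma exists_free_minimal_action:
  "\<exists>\<alpha> :: 'g \<Rightarrow> cantor \<Rightarrow> cantor.
    (\<forall>x. \<alpha> \<epsilon> x = x) \<and> (\<forall>g h x. \<alpha> (g \<odot> h) x = \<alpha> g (\<alpha> h x)) \<and> (\<forall>g. continuous_on UNIV (\<alpha> g)) \<and>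
    (\<forall>g x. g \<noteq> \<epsilon> \<longrightarrow> \<alpha> g x \<noteq> x) \<and> (\<forall>x U. open U \<longrightarrow> U \<noteq> {} \<longrightarrow> (\<exists>g. \<alpha> g x \<in> U)) \<and>
    (\<exists>\<mu>. prob_space \<mu> \<and> sets \<mu> = sets borel \<and> (\<forall>g. distr \<mu> borel (\<alpha> g) = \<mu>))"
proof -
  obtain D P where data: "\<And>n. level_data D P n" using exists_all_level_data by blast
  define Z where "Z = limit_set D P"
  have "\<exists>\<mu>. prob_space \<mu> \<and> sets \<mu> = sets borel \<and> (\<forall>g. distr \<mu> borel (shift g) = \<mu>) \<and>
      emeasure \<mu> (\<Inter>n. {x. legal D P n (Collect x)}) = 1"
  proof (rule invariant_measure_on_Inter)
    show "decseq (\<lambda>n. {x. legal D P n (Collect x)})"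
      by (auto simp: decseq_def intro: legal_mono)
    show "closed {x. legal D P n (Collect x)}" for n
      by (rule closed_legal) (rule level_dataD(1)[OF data])
  qed (use continuous_shift exists_invariant_measure_on_legal data in auto)
  then obtain \<mu> where p: "prob_space \<mu>" and s: "sets \<mu> = sets borel"
    and inv: "\<And>g. distr \<mu> borel (shift g) = \<mu>" and full: "emeasure \<mu> Z = 1"
    unfolding Z_def limit_set_def by blast
  interpret prob_space \<mu> by fact
  have "Z \<noteq> {}" using full by auto
  have clZ: "closed Z" unfolding Z_def by (rule closed_limit_set[OF data])
  have ZI: "shift g x \<in> Z" if "x \<in> Z" for g x using that shift_limit_set by (simp add: Z_def)
  obtain h :: "_ \<Rightarrow> cantor" and h' where hom: "homeomorphism Z UNIV h h'"
    using homeomorphic_Cantor[OF clZ \<open>Z \<noteq> {}\<close>] limit_set_perfect[OF data] unfolding Z_def by blast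
  have h: "\<And>x. x \<in> Z \<Longrightarrow> h' (h x) = x" "\<And>z. h (h' z) = z" "\<And>z. h' z \<in> Z"
    "continuous_on Z h" "continuous_on UNIV h'"
    using hom by (auto simp: homeomorphism_def)
  define \<alpha> where "\<alpha> g z = h (shift g (h' z))" for g z
  have cont: "continuous_on UNIV (\<alpha> g)" for g
  proof -
    have "continuous_on UNIV (\<lambda>z. shift g (h' z))"
      by (rule continuous_on_compose2[OF continuous_shift h(5)]) simp
    then show ?thesis
      unfolding \<alpha>_def by (rule continuous_on_compose2[OF h(4)]) (use ZI h(3) in auto)
  qed
  have mult: "\<alpha> (g \<odot> g') z = \<alpha> g (\<alpha> g' z)" for g g' z
    by (simp add: \<alpha>_def shift_mult h ZI)
  have free: "\<alpha> g z \<noteq> z" if "g \<noteq> \<epsilon>" for g z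
  proof
    assume "\<alpha> g z = z"
    then have "h' (h (shift g (h' z))) = h' z" by (simp add: \<alpha>_def)
    then have "shift g (h' z) = h' z" by (simp add: h ZI)
    then show False using limit_set_free[OF data _ that] h(3) by (simp add: Z_def)
  qed
  have minimal: "\<exists>g. \<alpha> g z \<in> U" if U: "open U" "U \<noteq> {}" for z U
  proof -
    obtain w where w: "w \<in> U" using U by blast
    have "openin (top_of_set Z) (Z \<inter> h -` U)"
      using continuous_openin_preimage_gen[OF h(4) U(1)] .
    then obtain V where V: "open V" "Z \<inter> h -` U = Z \<inter> V" by (auto simp: openin_open)
    have "h' w \<in> Z \<inter> h -` U" using w h by simp
    then have "h' w \<in> V" using V by blast
    then obtain g where "shift g (h' z) \<in> V"
      using limit_set_minimal[OF data, of "h' z" "h' w" V] h(3) V(1) by (auto simp: Z_def)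
    then have "shift g (h' z) \<in> Z \<inter> h -` U" using V(2) ZI h(3) by blast
    then have "\<alpha> g z \<in> U" by (simp add: \<alpha>_def)
    then show ?thesis ..
  qed
  \<comment> \<open>\<open>h\<close> as a function on the whole space; the arbitrary value is taken on a null set\<close>
  define H where "H x = (if x \<in> Z then h x else undefined)" for x
  have mH: "H \<in> borel_measurable borel"
    unfolding H_def using clZ h(4) by (intro borel_measurable_continuous_on_if) auto
  have mH': "H \<in> borel_measurable \<mu>" using mH s by (simp cong: measurable_cong_sets)
  have mS: "shift g \<in> borel_measurable borel" for g
    using continuous_shift by (rule borel_measurable_continuous_onI)
  have mS': "shift g \<in> measurable \<mu> borel" for g using mS s by (simp cong: measurable_cong_sets)
  have m\<alpha>: "\<alpha> g \<in> borel_measurable borel" for g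
    using cont by (rule borel_measurable_continuous_onI)
  have AE_Z: "AE x in \<mu>. x \<in> Z"
    using full by (intro AE_prob_1) (simp add: measure_def)
  define \<mu>' where "\<mu>' = distr \<mu> borel H"
  have "distr \<mu>' borel (\<alpha> g) = \<mu>'" for g
  proof -
    have "distr \<mu>' borel (\<alpha> g) = distr \<mu> borel (\<alpha> g \<circ> H)"
      unfolding \<mu>'_def using m\<alpha> mH' by (rule distr_distr)
    also have "\<dots> = distr \<mu> borel (H \<circ> shift g)"
    proof (rule distr_cong_AE)
      show "AE x in \<mu>. (\<alpha> g \<circ> H) x = (H \<circ> shift g) x"
        using AE_Z by eventually_elim (simp add: H_def \<alpha>_def h ZI)
      show "\<alpha> g \<circ> H \<in> measurable \<mu> borel" using mH' m\<alpha> by (rule measurable_comp)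
      show "H \<circ> shift g \<in> measurable \<mu> borel" using mS' mH by (rule measurable_comp)
    qed simp_all
    also have "\<dots> = distr (distr \<mu> borel (shift g)) borel H"
      using mH mS' by (rule distr_distr[symmetric])
    finally show ?thesis by (simp add: inv \<mu>'_def)
  qed
  moreover have "prob_space \<mu>'" unfolding \<mu>'_def using mH' by (rule prob_space_distr)
  moreover have "sets \<mu>' = sets borel" by (simp add: \<mu>'_def)
  ultimately have "\<exists>\<mu>. prob_space \<mu> \<and> sets \<mu> = sets borel \<and> (\<forall>g. distr \<mu> borel (\<alpha> g) = \<mu>)"
    by blast
  moreover have "\<alpha> \<epsilon> z = z" for z by (simp add: \<alpha>_def h)
  ultimately show ?thesis using mult cont free minimal by (intro exI[of _ \<alpha>] conjI allI impI)
qed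

end

theorem theorem1:
  fixes G :: "('a, 'b) monoid_scheme"
  assumes "group G" and "countable (carrier G)" and "infinite (carrier G)"
  shows "\<exists>\<alpha> :: 'a \<Rightarrow> cantor \<Rightarrow> cantor.
    continuous_action G \<alpha> \<and> free_action G \<alpha> \<and> minimal_action G \<alpha> \<and>
    (\<exists>\<mu>. invariant_borel_probability G \<alpha> \<mu>)"
proof -
  interpret G: group G by fact
  define f where "f = to_nat_on (carrier G)"
  have bij: "bij_betw f (carrier G) UNIV"
    unfolding f_def using assms(2,3) by (rule to_nat_on_infinite)
  define f' where "f' = inv_into (carrier G) f"
  have f: "f' n \<in> carrier G" "f (f' n) = n" "a \<in> carrier G \<Longrightarrow> f' (f a) = a" for n a
    using bij_betw_inv_into_right[OF bij] bij_betw_inv_into_left[OF bij]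
      bij_betwE[OF bij_betw_inv_into[OF bij]] by (auto simp: f'_def)
  define mul where "mul m n = f (f' m \<otimes>\<^bsub>G\<^esub> f' n)" for m n
  interpret N: discrete_group mul "f \<one>\<^bsub>G\<^esub>" "\<lambda>n. f (inv\<^bsub>G\<^esub> (f' n))"
    by unfold_locales (simp_all add: mul_def f G.m_assoc infinite_UNIV_nat)
  obtain \<beta> :: "nat \<Rightarrow> cantor \<Rightarrow> cantor" and \<mu> where
    one: "\<And>x. \<beta> (f \<one>\<^bsub>G\<^esub>) x = x" and mult: "\<And>m n x. \<beta> (mul m n) x = \<beta> m (\<beta> n x)"
    and cont: "\<And>n. continuous_on UNIV (\<beta> n)"
    and free: "\<And>n x. n \<noteq> f \<one>\<^bsub>G\<^esub> \<Longrightarrow> \<beta> n x \<noteq> x"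
    and minimal: "\<And>x U. open U \<Longrightarrow> U \<noteq> {} \<Longrightarrow> \<exists>n. \<beta> n x \<in> U"
    and \<mu>: "prob_space \<mu>" "sets \<mu> = sets borel" "\<And>n. distr \<mu> borel (\<beta> n) = \<mu>"
    using N.exists_free_minimal_action by (elim exE conjE) (rule that; assumption | blast)
  define \<alpha> where "\<alpha> g = \<beta> (f g)" for g
  have \<alpha>_mult: "\<alpha> (g \<otimes>\<^bsub>G\<^esub> h) x = \<alpha> g (\<alpha> h x)" if "g \<in> carrier G" "h \<in> carrier G" for g h x
    using that mult[of "f g" "f h" x] by (simp add: \<alpha>_def mul_def f)
  have \<alpha>_inv: "\<alpha> (inv\<^bsub>G\<^esub> g) (\<alpha> g x) = x" "\<alpha> g (\<alpha> (inv\<^bsub>G\<^esub> g) x) = x" if "g \<in> carrier G" for g x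
    using that \<alpha>_mult[of "inv\<^bsub>G\<^esub> g" g x] \<alpha>_mult[of g "inv\<^bsub>G\<^esub> g" x] by (simp_all add: \<alpha>_def one)
  have bij\<alpha>: "\<alpha> g \<in> Bij UNIV" if "g \<in> carrier G" for g
    using \<alpha>_inv[OF that] unfolding Bij_def by (auto intro!: bij_betw_byWitness[where f' = "\<alpha> (inv\<^bsub>G\<^esub> g)"])
  have "\<alpha> \<in> hom G (BijGroup UNIV)"
    using bij\<alpha> by (auto simp: hom_def BijGroup_def compose_def \<alpha>_mult fun_eq_iff)
  then have "group_action G UNIV \<alpha>"
    unfolding group_action_def group_hom_def group_hom_axioms_def
    using assms(1) group_BijGroup[of UNIV] by blast
  then have "continuous_action G \<alpha>" using cont by (simp add: continuous_action_def \<alpha>_def)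
  moreover have "free_action G \<alpha>"
    unfolding free_action_def
  proof (intro ballI impI allI)
    fix g x assume g: "g \<in> carrier G" "g \<noteq> \<one>\<^bsub>G\<^esub>"
    then have "f g \<noteq> f \<one>\<^bsub>G\<^esub>" by (metis f(3) G.one_closed)
    then show "\<alpha> g x \<noteq> x" unfolding \<alpha>_def by (rule free)
  qed
  moreover have "minimal_action G \<alpha>"
    unfolding minimal_action_def
  proof
    fix x
    have hits: "\<exists>y\<in>orbit G \<alpha> x. y \<in> U" if "open U" "U \<noteq> {}" for U
    proof -
      obtain n where "\<beta> n x \<in> U" using minimal[OF \<open>open U\<close> \<open>U \<noteq> {}\<close>] by blast
      then have "\<alpha> (f' n) x \<in> U" by (simp add: \<alpha>_def f)
      moreover have "\<alpha> (f' n) x \<in> orbit G \<alpha> x" using f(1) unfolding orbit_def by blast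
      ultimately show ?thesis by blast
    qed
    show "closure (orbit G \<alpha> x) = UNIV"
    proof (rule ccontr)
      assume "closure (orbit G \<alpha> x) \<noteq> UNIV"
      then have "- closure (orbit G \<alpha> x) \<noteq> {}" by blast
      with hits[OF open_Compl[OF closed_closure]]
      obtain y where "y \<in> orbit G \<alpha> x" "y \<in> - closure (orbit G \<alpha> x)" by meson
      then show False using closure_subset[of "orbit G \<alpha> x"] by (simp add: subset_eq)
    qed
  qed
  moreover have "invariant_borel_probability G \<alpha> \<mu>"
    using \<mu> by (simp add: invariant_borel_probability_def \<alpha>_def)
  ultimately show ?thesis by blast
qed

end
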